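(* Let $K$ be an uncountable compact metric space and let $d\in \mathbb{N}^+$. Then for a prevalent $f\in C(K,\mathbb{R}^d)$ we have \[ \dim_P \operatorname{graph}(f)=\dim_P K+d. \]
   Context: $C(K,\mathbb{R}^d)$ is the Banach space of continuous maps $K\to\mathbb{R}^d$ with the maximum norm, viewed as an abelian Polish group. A set $A\subset G$ in an abelian Polish group is shy if there exist a Borel set $B\supset A$ and a Borel probability measure $\mu$ on $G$ with $\mu(B+x)=0$ for all $x\in G$; prevalent means complement shy; "for a prevalent $f$" means the set of such $f$ contains a prevalent set. $K\times\mathbb{R}^d$ carries the metric $\sqrt{\rho(x_1,x_2)^2+|z_1-z_2|^2}$ and $\operatorname{graph}(f)=\{(x,f(x)):x\in K\}$. $N_n(X)$ is the maximal cardinality of a subset of $X$ with pairwise distances $>2^{-n}$; $\overline{\dim}_B X=\limsup_n\frac{\log N_n(X)}{n\log 2}$ for non-empty totally bounded $X$ (and $\infty$ otherwise); packing dimension is $\dim_P X=\inf\{\sup_i\overline{\dim}_B A_i: X\subset\bigcup_{i=1}^\infty A_i\}$. *)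

theory Defs
  imports "HOL-Probability.Probability"
begin

definition shy :: "'g::{ab_group_add, topological_space} set \<Rightarrow> bool" where
  "shy A \<longleftrightarrow> (\<exists>B \<in> sets borel. A \<subseteq> B \<and>
      (\<exists>\<mu>. prob_space \<mu> \<and> sets \<mu> = sets (borel :: 'g measure) \<and>
           (\<forall>x. emeasure \<mu> ((\<lambda>b. b + x) ` B) = 0)))"

definition prevalent :: "'g::{ab_group_add, topological_space} set \<Rightarrow> bool" where
  "prevalent S \<longleftrightarrow> shy (- S)"

definition for_prevalent :: "('g::{ab_group_add, topological_space} \<Rightarrow> bool) \<Rightarrow> bool" where
  "for_prevalent P \<longleftrightarrow> (\<exists>S. prevalent S \<and> S \<subseteq> {f. P f})"

definition totally_bdd :: "'a::metric_space set \<Rightarrow> bool" where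
  "totally_bdd X \<longleftrightarrow> (\<forall>e>0. \<exists>F. finite F \<and> X \<subseteq> (\<Union>x\<in>F. ball x e))"

definition packing_number :: "nat \<Rightarrow> 'a::metric_space set \<Rightarrow> nat" where
  "packing_number n X = Sup {card F | F. finite F \<and> F \<subseteq> X \<and>
      (\<forall>x\<in>F. \<forall>y\<in>F. x \<noteq> y \<longrightarrow> dist x y > (1/2) ^ n)}"

definition upper_box_dim :: "'a::metric_space set \<Rightarrow> ereal" where
  "upper_box_dim X = (if X \<noteq> {} \<and> totally_bdd X
     then limsup (\<lambda>n. ereal (ln (real (packing_number n X)) / (real n * ln 2)))
     else \<infinity>)"

definition packing_dim :: "'a::metric_space set \<Rightarrow> ereal" where
  "packing_dim X = Inf {Sup (range (\<lambda>i. upper_box_dim (A i))) | A :: nat \<Rightarrow> 'a set.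
                        X \<subseteq> (\<Union>i. A i)}"

definition graph_of :: "('a::topological_space \<Rightarrow>\<^sub>C 'b::metric_space) \<Rightarrow> ('a \<times> 'b) set" where
  "graph_of f = {(x, apply_bcontfun f x) | x. True}"

end

theory Submission
  imports Defs "HOL-Real_Asymp.Real_Asymp"
begin

text \<open>
  Let \<open>d\<close> be the dimension of the target. The upper bound holds for every \<open>f\<close>, because a cell of
  size \<open>2\<^sup>-\<^sup>n\<close> in the domain meets at most \<open>O(2\<^sup>n\<^sup>d)\<close> cells of the bounded range.

  For the lower bound let \<open>s < dim\<^sub>P K\<close> and delete from \<open>K\<close> all basic open sets that are countable
  unions of countable sets and sets of upper box dimension below \<open>s\<close>. The remaining kernel is
  non-empty, and each of its relatively open pieces \<open>A\<close> has no isolated points and upper box dimension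
  at least \<open>s\<close>. By Baire's theorem in the kernel it is enough that, for a prevalent \<open>f\<close> and each of
  countably many pieces \<open>A\<close>, the graph of \<open>f\<close> over \<open>A\<close> has upper box dimension at least \<open>s + d\<close>.

  The probe measure is the law of \<open>(t\<^sub>1 F\<^sub>1, \<dots>, t\<^sub>d F\<^sub>d)\<close> with \<open>t\<close> uniform in the unit cube, for one
  fixed map \<open>F\<close>. A generic \<open>F\<close> has this property for every piece \<open>A\<close> and infinitely many scales \<open>n\<close>:
  near each of about \<open>2\<^sup>n\<^sup>s\<close> separated points of \<open>A\<close> it takes values that are spread out like a grid of
  mesh \<open>2\<^sup>-\<^sup>n\<close> with almost \<open>2\<^sup>n\<^sup>d\<close> nodes. Whatever map \<open>g\<close> is subtracted, two nodes with indices \<open>j\<close>,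
  \<open>j'\<close> come \<open>2\<^sup>-\<^sup>n\<close>-close with probability at most the product of the numbers \<open>1 / |j\<^sub>c - j'\<^sub>c|\<close>. Summing
  harmonic series, the expected number of collisions is the number of nodes up to a factor polynomial
  in \<open>n\<close>, and Markov's and Cauchy's inequalities yield about \<open>2\<^sup>n\<^sup>s\<^sup>+\<^sup>n\<^sup>d\<close> separated points of the graph.
\<close>

subsection \<open>Packing numbers and box dimension\<close>

definition separated :: "nat \<Rightarrow> 'a::metric_space set \<Rightarrow> bool" where
  "separated n F \<longleftrightarrow> (\<forall>x\<in>F. \<forall>y\<in>F. x \<noteq> y \<longrightarrow> dist x y > (1/2) ^ n)"

lemma totally_bdd_subset: "totally_bdd X \<Longrightarrow> Y \<subseteq> X \<Longrightarrow> totally_bdd Y"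
  unfolding totally_bdd_def by (meson subset_trans)

lemma compact_imp_totally_bdd: "compact X \<Longrightarrow> totally_bdd X"
  unfolding totally_bdd_def compact_eq_totally_bounded by blast

text \<open>A ball of radius \<open>(1/2) ^ n / 2\<close> holds at most one point of a separated
  set. The bound is what gives the \<open>Sup\<close> of naturals in \<open>packing_number\<close>
  its intended meaning.\<close>

lemma packing_number_bdd:
  assumes "totally_bdd X"
  shows "\<exists>M. \<forall>F. finite F \<and> F \<subseteq> X \<and> separated n F \<longrightarrow> card F \<le> M"
proof -
  obtain C where C: "finite C" "X \<subseteq> (\<Union>x\<in>C. ball x ((1/2) ^ n / 2))"
    using assms unfolding totally_bdd_def by (elim allE[of _ "(1/2) ^ n / 2"]) auto
  have "card F \<le> card C" if F: "finite F" "F \<subseteq> X" "separated n F" for F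
  proof -
    have "\<forall>x\<in>F. \<exists>c. c \<in> C \<and> dist c x < (1/2) ^ n / 2"
      using C(2) F(2) by (auto simp: subset_eq)
    then obtain h where h: "\<And>x. x \<in> F \<Longrightarrow> h x \<in> C \<and> dist (h x) x < (1/2) ^ n / 2"
      by metis
    have "inj_on h F"
    proof (rule inj_onI, rule ccontr)
      fix x y assume xy: "x \<in> F" "y \<in> F" "h x = h y" "x \<noteq> y"
      have "dist x y \<le> dist (h x) x + dist (h x) y" by (rule dist_triangle3)
      also have "\<dots> < (1/2) ^ n" using h[OF xy(1)] h[OF xy(2)] xy(3) by simp
      finally show False using F(3) xy unfolding separated_def by force
    qed
    then show ?thesis using h C(1) by (meson card_inj_on_le image_subsetI)
  qed
  then show ?thesis by blast
qed

lemma packing_number_ge: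
  assumes "totally_bdd X" "finite F" "F \<subseteq> X" "separated n F"
  shows "card F \<le> packing_number n X"
proof -
  obtain M where "\<And>F. finite F \<and> F \<subseteq> X \<and> separated n F \<Longrightarrow> card F \<le> M"
    using packing_number_bdd[OF assms(1)] by blast
  then have "bdd_above {card F | F. finite F \<and> F \<subseteq> X \<and> separated n F}"
    by (auto intro!: bdd_aboveI)
  then show ?thesis
    unfolding packing_number_def separated_def[symmetric]
    by (intro cSup_upper) (use assms in auto)
qed

lemma packing_number_attained:
  assumes "totally_bdd X"
  obtains F where "finite F" "F \<subseteq> X" "separated n F" "card F = packing_number n X"
proof -
  let ?S = "{card F | F. finite F \<and> F \<subseteq> X \<and> separated n F}"
  obtain M where "\<And>F. finite F \<and> F \<subseteq> X \<and> separated n F \<Longrightarrow> card F \<le> M"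
    using packing_number_bdd[OF assms(1)] by blast
  then have "?S \<subseteq> {..M}" by auto
  then have "finite ?S" by (rule finite_subset) simp
  moreover have "card ({}::'a set) \<in> ?S" unfolding separated_def by blast
  then have "?S \<noteq> {}" by blast
  ultimately have "Max ?S \<in> ?S" and "Sup ?S = Max ?S"
    by (rule Max_in, rule cSup_eq_Max)
  then show thesis using that unfolding packing_number_def separated_def[symmetric] by force
qed

lemma packing_number_pos:
  assumes "totally_bdd X" "X \<noteq> {}"
  shows "1 \<le> packing_number n X"
proof -
  obtain x where "x \<in> X" using assms(2) by blast
  then show ?thesis using packing_number_ge[OF assms(1), of "{x}" n] by (simp add: separated_def)
qed

text \<open>Maximality turns packing into covering: a point farther than \<open>(1/2) ^ n\<close>
  from all of \<open>F\<close> could be added to \<open>F\<close>.\<close>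

lemma packing_net:
  assumes "totally_bdd X"
  obtains F where "finite F" "F \<subseteq> X" "separated n F" "card F = packing_number n X"
    "\<And>x. x \<in> X \<Longrightarrow> \<exists>y\<in>F. dist x y \<le> (1/2) ^ n"
proof -
  obtain F where F: "finite F" "F \<subseteq> X" "separated n F" "card F = packing_number n X"
    using packing_number_attained[OF assms] .
  have "\<exists>y\<in>F. dist x y \<le> (1/2) ^ n" if "x \<in> X" for x
  proof (rule ccontr)
    assume far: "\<not> ?thesis"
    then have "x \<notin> F" by force
    moreover have "separated n (insert x F)"
      using far F(3) unfolding separated_def by (metis dist_commute insertE not_le)
    ultimately show False
      using packing_number_ge[OF assms, of "insert x F" n] F that by simp
  qed
  then show thesis using that F by blast
qed

lemma packing_number_mono:
  assumes "totally_bdd Y" "X \<subseteq> Y"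
  shows "packing_number n X \<le> packing_number n Y"
proof -
  obtain F where "finite F" "F \<subseteq> X" "separated n F" "card F = packing_number n X"
    using packing_number_attained[OF totally_bdd_subset[OF assms]] .
  then show ?thesis using packing_number_ge[OF assms(1), of F n] assms(2) by auto
qed

text \<open>Finitely many strict inequalities leave a uniform margin. It serves to move points of a
  closure into the set, and to replace each separated point by a cluster.\<close>

lemma separated_near:
  assumes "finite F" "separated n F"
  obtains d where "d > 0"
    "\<And>x y x' y'. x \<in> F \<Longrightarrow> y \<in> F \<Longrightarrow> x \<noteq> y \<Longrightarrow> dist x x' < d \<Longrightarrow> dist y y' < d \<Longrightarrow> dist x' y' > (1/2) ^ n"
proof -
  let ?D = "(\<lambda>(x,y). dist x y - (1/2) ^ n) ` ((F \<times> F) - Id)"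
  \<comment> \<open>The 1 keeps \<open>Min\<close> meaningful when \<open>F\<close> has at most one
    point; the division by 2 shares the margin between the two moved points.\<close>
  define d where "d = Min (insert 1 ?D) / 2"
  have fin: "finite (insert 1 ?D)" using assms(1) by simp
  have "0 < p" if "p \<in> insert 1 ?D" for p
    using that assms(2) unfolding separated_def by force
  then have "d > 0"
    unfolding d_def using fin by (subst half_gt_zero_iff, subst Min_gr_iff) auto
  moreover have "dist x' y' > (1/2) ^ n"
    if "x \<in> F" "y \<in> F" "x \<noteq> y" "dist x x' < d" "dist y y' < d" for x y x' y'
  proof -
    have "2 * d \<le> dist x y - (1/2) ^ n"
      unfolding d_def using fin that by (auto intro!: Min_le)
    moreover have "dist x y \<le> dist x x' + dist x' y' + dist y y'"
      by (smt (verit) dist_commute dist_triangle)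
    ultimately show ?thesis using that by linarith
  qed
  ultimately show thesis using that by blast
qed

text \<open>Passing to closures costs nothing because separation is strict. The Baire argument works
  with closed sets and relies on this.\<close>

lemma packing_number_closure_le:
  assumes "totally_bdd (closure X)"
  shows "packing_number n (closure X) \<le> packing_number n X"
proof -
  obtain F where F: "finite F" "F \<subseteq> closure X" "separated n F" "card F = packing_number n (closure X)"
    using packing_number_attained[OF assms] .
  obtain d where d: "d > 0"
    "\<And>x y x' y'. x \<in> F \<Longrightarrow> y \<in> F \<Longrightarrow> x \<noteq> y \<Longrightarrow> dist x x' < d \<Longrightarrow> dist y y' < d \<Longrightarrow> dist x' y' > (1/2) ^ n"
    using separated_near[OF F(1,3)] by blast
  have "\<forall>x\<in>F. \<exists>x'\<in>X. dist x x' < d"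
    using F(2) d(1) by (metis closure_approachable dist_commute subsetD)
  then obtain h where h: "\<And>x. x \<in> F \<Longrightarrow> h x \<in> X \<and> dist x (h x) < d" by metis
  have sep: "dist (h x) (h y) > (1/2) ^ n" if "x \<in> F" "y \<in> F" "x \<noteq> y" for x y
    using d(2) h that by blast
  have "inj_on h F"
  proof (rule inj_onI, rule ccontr)
    fix x y assume "x \<in> F" "y \<in> F" "h x = h y" "x \<noteq> y"
    then have "(1/2) ^ n < (0::real)" using sep[of x y] by simp
    then show False by (simp add: not_less[symmetric])
  qed
  then have "card F = card (h ` F)" by (simp add: card_image)
  also have "\<dots> \<le> packing_number n X"
    using totally_bdd_subset[OF assms closure_subset] F(1) h sep
    by (intro packing_number_ge) (auto simp: separated_def)
  finally show ?thesis using F(4) by simp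
qed

lemma totally_bdd_closure:
  assumes "totally_bdd X"
  shows "totally_bdd (closure X)"
  unfolding totally_bdd_def
proof (intro allI impI)
  fix e :: real assume e: "e > 0"
  then obtain C where C: "finite C" "X \<subseteq> (\<Union>x\<in>C. ball x (e/2))"
    using assms unfolding totally_bdd_def by (meson half_gt_zero)
  have "X \<subseteq> (\<Union>x\<in>C. cball x (e/2))" using C(2) by force
  then have "closure X \<subseteq> (\<Union>x\<in>C. cball x (e/2))"
    by (intro closure_minimal closed_UN) (use C in auto)
  also have "\<dots> \<subseteq> (\<Union>x\<in>C. ball x e)" using e by auto
  finally show "\<exists>F. finite F \<and> closure X \<subseteq> (\<Union>x\<in>F. ball x e)" using C(1) by blast
qed

section \<open>Upper box dimension as exponential growth of packing numbers\<close>

lemma ln_packing_iff: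
  assumes "1 \<le> N" "n > 0"
  shows "ln (real N) / (real n * ln 2) \<le> u \<longleftrightarrow> real N \<le> 2 powr (n * u)"
    and "u \<le> ln (real N) / (real n * ln 2) \<longleftrightarrow> 2 powr (n * u) \<le> real N"
proof -
  have pos: "real n * ln 2 > 0" using assms by simp
  have ex: "2 powr (n * u) = exp (u * (real n * ln 2))" by (simp add: powr_def mult_ac)
  have N: "exp (ln (real N)) = real N" using assms by simp
  show "ln (real N) / (real n * ln 2) \<le> u \<longleftrightarrow> real N \<le> 2 powr (n * u)"
    unfolding ex pos_divide_le_eq[OF pos] using exp_le_cancel_iff[of "ln (real N)"] unfolding N by simp
  show "u \<le> ln (real N) / (real n * ln 2) \<longleftrightarrow> 2 powr (n * u) \<le> real N"
    unfolding ex pos_le_divide_eq[OF pos] using exp_le_cancel_iff[of _ "ln (real N)"] unfolding N by simp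
qed

lemma upper_box_dim_nonneg: "0 \<le> upper_box_dim X"
proof (cases "X \<noteq> {} \<and> totally_bdd X")
  case True
  have "0 \<le> limsup (\<lambda>n. ereal (ln (real (packing_number n X)) / (real n * ln 2)))"
  proof (intro le_Limsup always_eventually allI)
    fix n
    have "1 \<le> packing_number n X" using packing_number_pos True by blast
    then show "0 \<le> ereal (ln (real (packing_number n X)) / (real n * ln 2))" by simp
  qed simp
  then show ?thesis using True by (simp add: upper_box_dim_def)
qed (auto simp: upper_box_dim_def)

lemma upper_box_dim_finiteD:
  assumes "upper_box_dim X < u"
  shows "X \<noteq> {}" "totally_bdd X"
  using assms by (auto simp: upper_box_dim_def split: if_splits)

lemma upper_box_dim_less_imp:
  fixes u :: real
  assumes "upper_box_dim X < ereal u"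
  shows "eventually (\<lambda>n. real (packing_number n X) \<le> 2 powr (n * u)) sequentially"
proof -
  note X = upper_box_dim_finiteD[OF assms]
  have "limsup (\<lambda>n. ereal (ln (real (packing_number n X)) / (real n * ln 2))) < u"
    using assms X by (simp add: upper_box_dim_def)
  then have "eventually (\<lambda>n. ereal (ln (real (packing_number n X)) / (real n * ln 2)) < u) sequentially"
    by (rule Limsup_lessD)
  then show ?thesis
    using eventually_gt_at_top[of 0]
    by eventually_elim (subst ln_packing_iff(1)[symmetric], use packing_number_pos[OF X(2,1)] in auto)
qed

lemma upper_box_dim_leI:
  fixes u :: real
  assumes "X \<noteq> {}" "totally_bdd X"
    and "eventually (\<lambda>n. real (packing_number n X) \<le> 2 powr (n * u)) sequentially"
  shows "upper_box_dim X \<le> ereal u"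
proof -
  have "eventually (\<lambda>n. ereal (ln (real (packing_number n X)) / (real n * ln 2)) \<le> ereal u) sequentially"
    using assms(3) eventually_gt_at_top[of 0]
    by eventually_elim
      (simp only: ereal_less_eq, subst ln_packing_iff(1), use packing_number_pos[OF assms(2,1)] in auto)
  then show ?thesis using assms(1,2) by (simp add: upper_box_dim_def Limsup_bounded)
qed

text \<open>A limsup yields only infinitely many scales, which is why
  \<open>packing_dim_graph_ge\<close> asks for \<open>frequently\<close> only.\<close>

lemma upper_box_dim_ge_imp:
  fixes u v :: real
  assumes "ereal u \<le> upper_box_dim X" "X \<noteq> {}" "totally_bdd X" "v < u"
  shows "frequently (\<lambda>n. 2 powr (n * v) \<le> real (packing_number n X)) sequentially"
proof (rule ccontr)
  assume "\<not> ?thesis"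
  then have "eventually (\<lambda>n. real (packing_number n X) \<le> 2 powr (n * v)) sequentially"
    unfolding not_frequently by (rule eventually_mono) simp
  then have "upper_box_dim X \<le> ereal v" using assms by (intro upper_box_dim_leI)
  with assms(1) have "ereal u \<le> ereal v" by (rule order_trans)
  then show False using assms(4) by simp
qed

lemma upper_box_dim_singleton: "upper_box_dim {x} = 0"
proof (rule antisym)
  have tb: "totally_bdd {x}" by (intro compact_imp_totally_bdd) simp
  have "packing_number n {x} \<le> 1" for n
  proof -
    obtain F where "F \<subseteq> {x}" "card F = packing_number n {x}"
      using packing_number_attained[OF tb] .
    then show ?thesis using card_mono[of "{x}" F] by simp
  qed
  then have "real (packing_number n {x}) \<le> 2 powr (n * 0)" for n by simp
  then show "upper_box_dim {x} \<le> 0"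
    unfolding zero_ereal_def by (intro upper_box_dim_leI tb always_eventually allI) simp_all
qed (rule upper_box_dim_nonneg)

lemma packing_dim_le:
  assumes "X \<subseteq> (\<Union>i. A i)" "\<And>i::nat. upper_box_dim (A i) \<le> u"
  shows "packing_dim X \<le> u"
proof -
  have "packing_dim X \<le> Sup (range (\<lambda>i. upper_box_dim (A i)))"
    unfolding packing_dim_def using assms(1) by (intro Inf_lower) blast
  also have "\<dots> \<le> u" by (rule SUP_least) (rule assms(2))
  finally show ?thesis .
qed

lemma packing_dim_lessE:
  assumes "packing_dim X < u"
  obtains A where "X \<subseteq> (\<Union>i. A i)" "\<And>i::nat. upper_box_dim (A i) < u"
proof -
  obtain A :: "nat \<Rightarrow> 'a set" where A: "X \<subseteq> (\<Union>i. A i)" "Sup (range (\<lambda>i. upper_box_dim (A i))) < u"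
    using assms unfolding packing_dim_def Inf_less_iff by blast
  have "upper_box_dim (A i) < u" for i
    by (rule SUP_lessD[OF A(2) UNIV_I])
  then show thesis using that A(1) by blast
qed

section \<open>Graphs over subsets of the domain\<close>

definition graph_on :: "('a::metric_space \<Rightarrow>\<^sub>C 'b::metric_space) \<Rightarrow> 'a set \<Rightarrow> ('a \<times> 'b) set" where
  "graph_on f A = (\<lambda>x. (x, apply_bcontfun f x)) ` A"

lemma graph_of_eq: "graph_of f = graph_on f UNIV"
  by (auto simp: graph_of_def graph_on_def)

lemma graph_on_mono: "A \<subseteq> B \<Longrightarrow> graph_on f A \<subseteq> graph_on f B"
  by (auto simp: graph_on_def)

lemma continuous_on_graph_map:
  "continuous_on S (\<lambda>x. (x, apply_bcontfun f x))"
  by (intro continuous_intros continuous_on_apply_bcontfun)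

lemma totally_bdd_UNIV: "compact (UNIV :: 'a::metric_space set) \<Longrightarrow> totally_bdd (A :: 'a set)"
  using totally_bdd_subset[OF compact_imp_totally_bdd] by blast

lemma totally_bdd_graph_on:
  assumes "compact (UNIV :: 'a::metric_space set)"
  shows "totally_bdd (graph_on (f :: 'a \<Rightarrow>\<^sub>C 'b::metric_space) A)"
proof -
  have "compact (graph_on f UNIV)"
    unfolding graph_on_def by (intro compact_continuous_image continuous_on_graph_map assms)
  from totally_bdd_subset[OF compact_imp_totally_bdd[OF this] graph_on_mono[OF subset_UNIV]]
  show ?thesis .
qed

text \<open>
  Sending each point to a nearby point of a maximal separated set, the collisions contain the squares
  of all fibres, so Cauchy's inequality applies.
\<close>

lemma packing_number_collisions:
  fixes p :: "'i \<Rightarrow> 'a::metric_space"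
  assumes V: "finite V" and X: "totally_bdd X" "p ` V \<subseteq> X"
  shows "(card V)\<^sup>2 \<le> card {(v,w) \<in> V \<times> V. dist (p v) (p w) \<le> (1/2) ^ n} * packing_number (Suc n) X"
proof -
  obtain F where F: "finite F" "card F = packing_number (Suc n) (p ` V)"
    "\<And>x. x \<in> p ` V \<Longrightarrow> \<exists>y\<in>F. dist x y \<le> (1/2) ^ Suc n"
    by (rule packing_net[OF totally_bdd_subset[OF X], of "Suc n"]) (rule that)
  then have "\<forall>v\<in>V. \<exists>y. y \<in> F \<and> dist (p v) y \<le> (1/2) ^ Suc n" by blast
  then obtain q where q: "\<And>v. v \<in> V \<Longrightarrow> q v \<in> F \<and> dist (p v) (q v) \<le> (1/2) ^ Suc n" by metis
  define S where "S x = {v\<in>V. q v = x}" for x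
  have finS: "finite (S x)" for x using V by (simp add: S_def)
  have "card V = card (\<Union>x\<in>F. S x)"
    using q by (intro arg_cong[where f=card]) (auto simp: S_def)
  also have "\<dots> = (\<Sum>x\<in>F. card (S x))"
    using F(1) finS by (intro card_UN_disjoint) (auto simp: S_def)
  finally have sum: "real (card V) = (\<Sum>x\<in>F. real (card (S x)))" by simp
  have close: "dist (p v) (p w) \<le> (1/2) ^ n" if "v \<in> V" "w \<in> V" "q v = q w" for v w
  proof -
    have "dist (p v) (p w) \<le> dist (p v) (q v) + dist (p w) (q v)"
      by (rule dist_triangle2)
    also have "\<dots> \<le> (1/2) ^ Suc n + (1/2) ^ Suc n"
      using q[OF that(1)] q[OF that(2)] that(3) by (intro add_mono) auto
    finally show ?thesis by simp
  qed
  have "(\<Sum>x\<in>F. (card (S x))\<^sup>2) = (\<Sum>x\<in>F. card (S x \<times> S x))"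
    by (simp add: card_cartesian_product power2_eq_square)
  also have "\<dots> = card (\<Union>x\<in>F. S x \<times> S x)"
    using F(1) finS by (intro card_UN_disjoint[symmetric]) (auto simp: S_def)
  also have "\<dots> \<le> card {(v,w) \<in> V \<times> V. dist (p v) (p w) \<le> (1/2) ^ n}"
    using V close by (intro card_mono finite_subset[OF _ finite_cartesian_product[OF V V]]) (auto simp: S_def)
  finally have sq: "(\<Sum>x\<in>F. (card (S x))\<^sup>2) \<le> card {(v,w) \<in> V \<times> V. dist (p v) (p w) \<le> (1/2) ^ n}" .
  have "real ((card V)\<^sup>2) \<le> (\<Sum>x\<in>F. (real (card (S x)))\<^sup>2) * card F"
    unfolding of_nat_power sum by (rule sum_squared_le_sum_of_squares)
  also have "\<dots> = real ((\<Sum>x\<in>F. (card (S x))\<^sup>2) * card F)" by simp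
  finally have "(card V)\<^sup>2 \<le> (\<Sum>x\<in>F. (card (S x))\<^sup>2) * card F" by (simp only: of_nat_le_iff)
  also have "\<dots> \<le> card {(v,w) \<in> V \<times> V. dist (p v) (p w) \<le> (1/2) ^ n} * packing_number (Suc n) X"
    using sq F(2) packing_number_mono[OF X] by (intro mult_mono) auto
  finally show ?thesis .
qed

subsection \<open>The upper bound\<close>

text \<open>A point of the graph is encoded by a net point near its first component and the grid
  cell of its value. Points with the same code are at distance at most \<open>(1/2) ^ n\<close>, so
  the encoding is injective on a separated set, and counting codes gives the bound.\<close>

lemma packing_number_graph_le:
  fixes f :: "'a::metric_space \<Rightarrow>\<^sub>C (real ^ 'n)" and R :: nat
  assumes K: "compact (UNIV :: 'a set)" and R: "\<And>x. norm (apply_bcontfun f x) \<le> real R"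
  shows "real (packing_number n (graph_on f A)) \<le>
    real (packing_number (n + 2) A) * (real (4 * R * CARD('n) + 1) * 2 ^ n) ^ CARD('n)"
proof -
  define d where "d = CARD('n)"
  have d: "d > 0" by (simp add: d_def)
  \<comment> \<open>In a cell of side \<open>1 / T'\<close> the coordinate differences sum to at
    most \<open>d / T' = (1/2) ^ (n + 1)\<close>, which bounds the norm. The bound \<open>R\<close>
    on \<open>f\<close> confines the cell indices to \<open>{-T..T}\<close>.\<close>
  define T' :: nat where "T' = 2 ^ (n + 1) * d"
  define T :: int where "T = int (R * T')"
  obtain F where F: "finite F" "F \<subseteq> graph_on f A" "separated n F" "card F = packing_number n (graph_on f A)"
    using packing_number_attained[OF totally_bdd_graph_on[OF K]] .
  \<comment> \<open>Two points sharing a net point are within twice \<open>(1/2) ^ (n + 2)\<close>;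
    the other half of \<open>(1/2) ^ n\<close> is left for the values.\<close>
  obtain X where X: "finite X" "card X = packing_number (n + 2) A"
    "\<And>x. x \<in> A \<Longrightarrow> \<exists>y\<in>X. dist x y \<le> (1/2) ^ (n + 2)"
    by (rule packing_net[OF totally_bdd_UNIV[OF K], of A "n + 2"]) (rule that)
  then have "\<forall>x\<in>A. \<exists>y. y \<in> X \<and> dist x y \<le> (1/2) ^ (n + 2)" by blast
  then obtain h where h: "\<And>x. x \<in> A \<Longrightarrow> h x \<in> X \<and> dist x (h x) \<le> (1/2) ^ (n + 2)" by metis
  define \<phi> :: "'a \<times> (real ^ 'n) \<Rightarrow> 'a \<times> ('n \<Rightarrow> int)"
    where "\<phi> p = (h (fst p), \<lambda>c. \<lfloor>snd p $ c * real T'\<rfloor>)" for p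
  let ?C = "X \<times> PiE UNIV (\<lambda>_::'n. {-T..T})"
  have "inj_on \<phi> F"
  proof (rule inj_onI, rule ccontr)
    fix p q assume pq: "p \<in> F" "q \<in> F" "\<phi> p = \<phi> q" "p \<noteq> q"
    then have A: "fst p \<in> A" "fst q \<in> A" using F(2) by (auto simp: graph_on_def)
    have hh: "h (fst p) = h (fst q)" and fl: "\<lfloor>snd p $ c * real T'\<rfloor> = \<lfloor>snd q $ c * real T'\<rfloor>" for c
      using pq(3) by (auto simp: \<phi>_def fun_eq_iff)
    have "dist (fst p) (fst q) \<le> dist (fst p) (h (fst p)) + dist (fst q) (h (fst p))"
      by (rule dist_triangle2)
    also have "\<dots> \<le> (1/2) ^ (n + 2) + (1/2) ^ (n + 2)"
      using h[OF A(1)] h[OF A(2)] hh by (intro add_mono) auto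
    finally have 1: "dist (fst p) (fst q) \<le> (1/2) ^ (n + 1)" by simp
    have T': "real T' > 0" using d by (simp add: T'_def)
    have "\<bar>(snd p - snd q) $ c\<bar> \<le> 1 / real T'" for c
    proof -
      have "\<bar>snd p $ c * real T' - snd q $ c * real T'\<bar> \<le> 1" using fl[of c] by linarith
      then have "\<bar>(snd p - snd q) $ c\<bar> * real T' \<le> 1"
        using T' by (simp add: left_diff_distrib[symmetric] abs_mult)
      then show ?thesis using T' by (simp add: pos_le_divide_eq)
    qed
    then have "(\<Sum>c\<in>UNIV. \<bar>(snd p - snd q) $ c\<bar>) \<le> (\<Sum>c\<in>(UNIV::'n set). 1 / real T')"
      by (intro sum_mono)
    also have "\<dots> = (1/2) ^ (n + 1)" using d by (simp add: T'_def d_def[symmetric] power_divide)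
    finally have 2: "dist (snd p) (snd q) \<le> (1/2) ^ (n + 1)"
      unfolding dist_norm using norm_le_l1_cart order_trans by blast
    have "dist p q \<le> dist (fst p) (fst q) + dist (snd p) (snd q)"
      unfolding dist_prod_def by (intro sqrt_sum_squares_le_sum) auto
    also have "\<dots> \<le> (1/2) ^ n" using 1 2 by simp
    finally show False using F(3) pq unfolding separated_def by force
  qed
  moreover have "\<phi> ` F \<subseteq> ?C"
  proof (rule image_subsetI)
    fix p assume "p \<in> F"
    then obtain x where x: "x \<in> A" "p = (x, apply_bcontfun f x)" using F(2) by (auto simp: graph_on_def)
    have "\<lfloor>f x $ c * real T'\<rfloor> \<in> {-T..T}" for c
    proof -
      have "\<bar>f x $ c * real T'\<bar> \<le> real R * real T'"
        unfolding abs_mult using R[of x] component_le_norm_cart[of "f x" c] by (intro mult_mono) auto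
      then have "\<bar>f x $ c * real T'\<bar> \<le> real_of_int T" by (simp add: T_def)
      then show ?thesis by (simp add: le_floor_iff floor_le_iff) linarith
    qed
    then show "\<phi> p \<in> ?C" using h x by (auto simp: \<phi>_def)
  qed
  moreover have "finite ?C" using X(1) by (intro finite_cartesian_product finite_PiE) auto
  ultimately have "card F \<le> card ?C" by (intro card_inj_on_le)
  also have "card ?C = packing_number (n + 2) A * (2 * R * T' + 1) ^ d"
    using X(2) by (simp add: card_cartesian_product card_PiE T_def d_def nat_add_distrib nat_mult_distrib mult.assoc)
  also have "\<dots> \<le> packing_number (n + 2) A * ((4 * R * d + 1) * 2 ^ n) ^ d"
  proof (intro mult_left_mono power_mono)
    have eq: "2 * R * T' = 4 * R * d * 2 ^ n" by (simp add: T'_def)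
    show "2 * R * T' + 1 \<le> (4 * R * d + 1) * 2 ^ n"
      unfolding eq add_mult_distrib by (intro add_mono) auto
  qed auto
  finally have "packing_number n (graph_on f A) \<le> packing_number (n + 2) A * ((4 * R * d + 1) * 2 ^ n) ^ d"
    using F(4) by simp
  then have "real (packing_number n (graph_on f A)) \<le> real (packing_number (n + 2) A * ((4 * R * d + 1) * 2 ^ n) ^ d)"
    by (simp only: of_nat_le_iff)
  then show ?thesis unfolding d_def of_nat_mult of_nat_power of_nat_numeral .
qed

text \<open>The count carries a constant independent of \<open>n\<close> and a shift of the scale by
  2, neither of which changes the growth rate: one \<open>e\<close> pays for the limsup, another for
  these constants.\<close>

lemma upper_box_dim_graph_le:
  fixes f :: "'a::metric_space \<Rightarrow>\<^sub>C (real ^ 'n)"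
  assumes K: "compact (UNIV :: 'a set)"
  shows "upper_box_dim (graph_on f A) \<le> upper_box_dim A + ereal (real CARD('n))"
proof (cases "upper_box_dim A")
  case (real u)
  define d where "d = CARD('n)"
  have A: "A \<noteq> {}" using real by (auto simp: upper_box_dim_def)
  obtain R :: nat where "norm f \<le> R" using real_arch_simple by blast
  then have R: "norm (apply_bcontfun f x) \<le> real R" for x
    using norm_bounded[of f x] by linarith
  define C where "C = real (4 * R * CARD('n) + 1)"
  have C: "C > 0" by (simp add: C_def add_pos_nonneg)
  have "upper_box_dim (graph_on f A) \<le> ereal (u + d + 2 * e)" if e: "e > 0" for e
  proof (rule upper_box_dim_leI)
    show "graph_on f A \<noteq> {}" using A by (simp add: graph_on_def)
    show "totally_bdd (graph_on f A)" by (rule totally_bdd_graph_on[OF K])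
    have "upper_box_dim A < ereal (u + e)" using real e by simp
    from upper_box_dim_less_imp[OF this]
    have "eventually (\<lambda>n. real (packing_number (n + 2) A) \<le> 2 powr (real (n + 2) * (u + e))) sequentially"
      by (rule sequentially_offset)
    moreover have "eventually (\<lambda>n. 2 powr (2 * (u + e)) * C ^ d \<le> 2 powr (real n * e)) sequentially"
    proof -
      have "eventually (\<lambda>n. K \<le> 2 powr (real n * e)) sequentially" for K :: real
        using e by real_asymp
      then show ?thesis .
    qed
    ultimately show "eventually (\<lambda>n. real (packing_number n (graph_on f A)) \<le> 2 powr (real n * (u + d + 2 * e))) sequentially"
    proof eventually_elim
      case (elim n)
      have "real (packing_number n (graph_on f A)) \<le> real (packing_number (n + 2) A) * (C * 2 ^ n) ^ d"
        unfolding C_def d_def by (rule packing_number_graph_le[OF K R])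
      also have "\<dots> \<le> 2 powr (real (n + 2) * (u + e)) * (C * 2 ^ n) ^ d"
        using elim(1) C by (intro mult_right_mono) auto
      also have "\<dots> = (2 powr (2 * (u + e)) * C ^ d) * 2 powr (real n * (u + d + e))"
      proof -
        have "((2::real) ^ n) ^ d = 2 powr (real n * d)"
          by (metis of_nat_mult power_mult powr_realpow zero_less_numeral)
        moreover have "2 powr (real (n + 2) * (u + e)) = 2 powr (2 * (u + e)) * 2 powr (real n * (u + e))"
          by (simp only: powr_add[symmetric]) (simp add: algebra_simps)
        moreover have "2 powr (real n * (u + d + e)) = 2 powr (real n * (u + e)) * 2 powr (real n * d)"
          by (simp only: powr_add[symmetric]) (simp add: algebra_simps)
        ultimately show ?thesis by (simp add: power_mult_distrib)
      qed
      also have "\<dots> \<le> 2 powr (real n * e) * 2 powr (real n * (u + d + e))"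
        using elim(2) by (intro mult_right_mono) auto
      also have "\<dots> = 2 powr (real n * (u + d + 2 * e))"
        by (simp only: powr_add[symmetric]) (simp add: algebra_simps)
      finally show ?case .
    qed
  qed
  note bnd = this
  have "upper_box_dim (graph_on f A) \<le> upper_box_dim A + ereal (real CARD('n)) + ereal e" if "e > 0" for e
    using bnd[of "e/2"] that real by (simp add: d_def)
  then show ?thesis by (rule ereal_le_epsilon2)
qed (use upper_box_dim_nonneg[of A] in simp_all)

text \<open>The graphs over a cover of the domain cover the whole graph. The dimension of the target
  is moved to the left-hand side so that the infimum over covers can be taken.\<close>

lemma packing_dim_graph_le:
  fixes f :: "'a::metric_space \<Rightarrow>\<^sub>C (real ^ 'n)"
  assumes K: "compact (UNIV :: 'a set)"
  shows "packing_dim (graph_of f) \<le> packing_dim (UNIV :: 'a set) + ereal (real CARD('n))"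
proof -
  have "packing_dim (graph_of f) - ereal (real CARD('n)) \<le> Sup (range (\<lambda>i. upper_box_dim (A i)))"
    if A: "(UNIV :: 'a set) \<subseteq> (\<Union>i. A i)" for A :: "nat \<Rightarrow> 'a set"
  proof -
    have "packing_dim (graph_of f) \<le> Sup (range (\<lambda>i. upper_box_dim (A i))) + ereal (real CARD('n))"
    proof (rule packing_dim_le)
      show "graph_of f \<subseteq> (\<Union>i. graph_on f (A i))" using A unfolding graph_of_eq graph_on_def by blast
      show "upper_box_dim (graph_on f (A i)) \<le> Sup (range (\<lambda>i. upper_box_dim (A i))) + ereal (real CARD('n))" for i
        by (rule order_trans[OF upper_box_dim_graph_le[OF K]]) (intro add_right_mono SUP_upper UNIV_I)
    qed
    then show ?thesis by (simp add: ereal_minus_le)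
  qed
  then have "packing_dim (graph_of f) - ereal (real CARD('n)) \<le> packing_dim (UNIV :: 'a set)"
    unfolding packing_dim_def[of UNIV] by (intro Inf_greatest) blast
  then show ?thesis by (simp add: ereal_minus_le)
qed

subsection \<open>Kernels and the Baire argument in the domain\<close>

text \<open>
  Admitting countable sets separately keeps the kernels free of isolated points also for \<open>s \<le> 0\<close>,
  where no set has upper box dimension below \<open>s\<close>.
\<close>

definition small :: "real \<Rightarrow> 'a::metric_space set \<Rightarrow> bool" where
  "small s A \<longleftrightarrow> (\<exists>\<B>. countable \<B> \<and> A \<subseteq> \<Union>\<B> \<and> (\<forall>B\<in>\<B>. countable B \<or> upper_box_dim B < ereal s))"

lemma small_countable: "countable A \<Longrightarrow> small s A"
  unfolding small_def by (intro exI[of _ "{A}"]) auto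

lemma small_subset: "small s B \<Longrightarrow> A \<subseteq> B \<Longrightarrow> small s A"
  unfolding small_def by (meson subset_trans)

text \<open>Small sets form a sigma-ideal, so all small basic open sets can be discarded
  together.\<close>

lemma small_Union:
  assumes "countable \<A>" "\<And>A. A \<in> \<A> \<Longrightarrow> small s A"
  shows "small s (\<Union>\<A>)"
proof -
  have "\<forall>A\<in>\<A>. \<exists>\<B>. countable \<B> \<and> A \<subseteq> \<Union>\<B> \<and> (\<forall>B\<in>\<B>. countable B \<or> upper_box_dim B < ereal s)"
    using assms(2) unfolding small_def by blast
  then obtain H where H: "\<And>A. A \<in> \<A> \<Longrightarrow> countable (H A) \<and> A \<subseteq> \<Union>(H A) \<and> (\<forall>B\<in>H A. countable B \<or> upper_box_dim B < ereal s)"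
    by metis
  show ?thesis
    unfolding small_def
  proof (intro exI[of _ "\<Union>(H ` \<A>)"] conjI ballI)
    show "countable (\<Union>(H ` \<A>))" using assms(1) H by (intro countable_UN) auto
    show "\<Union>\<A> \<subseteq> \<Union>(\<Union>(H ` \<A>))"
    proof
      fix x assume "x \<in> \<Union>\<A>"
      then obtain A where "A \<in> \<A>" "x \<in> A" by blast
      then have "x \<in> \<Union>(H A)" using H[of A] by blast
      then show "x \<in> \<Union>(\<Union>(H ` \<A>))" using \<open>A \<in> \<A>\<close> by blast
    qed
    show "countable B \<or> upper_box_dim B < ereal s" if B: "B \<in> \<Union>(H ` \<A>)" for B
    proof -
      obtain A where "A \<in> \<A>" "B \<in> H A" using B by blast
      then show ?thesis using H[of A] by blast
    qed
  qed
qed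

lemma small_Un:
  assumes "small s A" "small s B"
  shows "small s (A \<union> B)"
proof -
  have "small s (\<Union>{A, B})"
  proof (rule small_Union)
    fix C assume "C \<in> {A, B}"
    then show "small s C" using assms by (elim insertE) simp_all
  qed simp
  then show ?thesis by simp
qed

text \<open>Countable members of a cover are split into points, of dimension 0. This is at most
  \<open>s\<close>: an uncountable space forces some member of dimension below \<open>s\<close>,
  hence \<open>0 < s\<close>.\<close>

lemma not_small_UNIV:
  assumes unc: "uncountable (UNIV :: 'a::metric_space set)" and s: "ereal s < packing_dim (UNIV :: 'a set)"
  shows "\<not> small s (UNIV :: 'a set)"
proof
  assume "small s (UNIV :: 'a set)"
  then obtain \<B> :: "'a set set" where B: "countable \<B>" "UNIV \<subseteq> \<Union>\<B>"
      "\<forall>B\<in>\<B>. countable B \<or> upper_box_dim B < ereal s"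
    unfolding small_def by (elim exE conjE) (rule that)
  have "\<exists>B\<in>\<B>. uncountable B"
  proof (rule ccontr)
    assume "\<not> ?thesis"
    then have "countable (\<Union>B\<in>\<B>. B)" using B(1) by (intro countable_UN) auto
    then show False using countable_subset[OF B(2)] unc by simp
  qed
  then obtain B :: "'a set" where "upper_box_dim B < ereal s" using B(3) by blast
  then have "0 < ereal s" using upper_box_dim_nonneg[of B] by (simp only: le_less_trans)
  then have s0: "0 < s" by simp
  define \<C> where "\<C> = {B\<in>\<B>. upper_box_dim B < ereal s} \<union> (\<lambda>x. {x}) ` (\<Union>{B\<in>\<B>. countable B})"
  have "countable (\<Union>B\<in>{B\<in>\<B>. countable B}. B)"
    using B(1) by (intro countable_UN) auto
  then have C1: "countable \<C>" unfolding \<C>_def using B(1) by simp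
  have cov: "UNIV \<subseteq> \<Union>\<C>"
  proof
    fix x :: 'a
    obtain B where "B \<in> \<B>" "x \<in> B" using B(2) by blast
    then show "x \<in> \<Union>\<C>" using bspec[OF B(3), of B] unfolding \<C>_def by auto
  qed
  then have ne: "\<C> \<noteq> {}" by auto
  have C2: "upper_box_dim C \<le> ereal s" if "C \<in> \<C>" for C
  proof -
    have "upper_box_dim C < ereal s \<or> (\<exists>x. C = {x})" using that unfolding \<C>_def by blast
    then show ?thesis using s0 by (elim disjE exE) (simp_all add: upper_box_dim_singleton)
  qed
  have "packing_dim (UNIV :: 'a set) \<le> ereal s"
  proof (rule packing_dim_le)
    show "UNIV \<subseteq> (\<Union>i. from_nat_into \<C> i)" using cov range_from_nat_into[OF ne C1] by simp
    show "upper_box_dim (from_nat_into \<C> i) \<le> ereal s" for i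
      using C2 from_nat_into[OF ne] by blast
  qed
  then show False using s by simp
qed

text \<open>The basis consists of balls of radius \<open>1 / Suc n\<close> around finite nets, which
  compactness supplies.\<close>

lemma compact_countable_basis:
  assumes "compact (UNIV :: 'a::metric_space set)"
  obtains \<U> :: "'a::metric_space set set" where "countable \<U>" "\<And>U. U \<in> \<U> \<Longrightarrow> open U"
    "\<And>V x. open V \<Longrightarrow> x \<in> V \<Longrightarrow> \<exists>U\<in>\<U>. x \<in> U \<and> U \<subseteq> V"
proof -
  have "\<forall>n. \<exists>C. finite C \<and> (UNIV :: 'a set) \<subseteq> (\<Union>c\<in>C. ball c (1 / Suc n))"
    using compact_imp_totally_bdd[OF assms] unfolding totally_bdd_def by simp
  then obtain C where C: "\<And>n. finite (C n)" "\<And>n. (UNIV :: 'a set) \<subseteq> (\<Union>c\<in>C n. ball c (1 / Suc n))"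
    by metis
  define \<U> where "\<U> = (\<Union>n. (\<lambda>c. ball c (1 / Suc n)) ` C n)"
  have "countable \<U>"
    unfolding \<U>_def using C(1) by (intro countable_UN countable_image) (auto intro: countable_finite)
  moreover have "open U" if "U \<in> \<U>" for U using that by (auto simp: \<U>_def)
  moreover have "\<exists>U\<in>\<U>. x \<in> U \<and> U \<subseteq> V" if V: "open V" "x \<in> V" for V x
  proof -
    obtain e where e: "e > 0" "ball x e \<subseteq> V" using V open_contains_ball by blast
    obtain n where n: "1 / Suc n < e / 2" using e(1) by (metis half_gt_zero nat_approx_posE)
    obtain c where c: "c \<in> C n" "x \<in> ball c (1 / Suc n)" using C(2)[of n] by blast
    have "ball c (1 / Suc n) \<subseteq> ball x e"
    proof
      fix y assume "y \<in> ball c (1 / Suc n)"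
      then have "dist x y < 1 / Suc n + 1 / Suc n"
        using c(2) dist_triangle[of x y c] by (simp add: dist_commute)
      then show "y \<in> ball x e" using n by simp
    qed
    then show ?thesis using c e(2) unfolding \<U>_def by blast
  qed
  ultimately show thesis using that by blast
qed

text \<open>Analogue of the perfect kernel of Cantor and Bendixson, with small sets in place of
  countable ones.\<close>

definition kernel :: "'a set set \<Rightarrow> real \<Rightarrow> 'a::metric_space set" where
  "kernel \<U> s = - \<Union>{U\<in>\<U>. small s U}"

lemma closed_kernel: "(\<And>U. U \<in> \<U> \<Longrightarrow> open U) \<Longrightarrow> closed (kernel \<U> s)"
  unfolding kernel_def by (intro closed_Compl open_Union) auto

lemma kernel_nonempty:
  assumes "countable \<U>" "\<not> small s (UNIV :: 'a::metric_space set)"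
  shows "kernel \<U> s \<noteq> ({} :: 'a set)"
proof
  assume "kernel \<U> s = {}"
  then have "UNIV = \<Union>{U\<in>\<U>. small s U}" unfolding kernel_def by auto
  moreover have "small s (\<Union>{U\<in>\<U>. small s U})"
    using assms(1) by (intro small_Union) auto
  ultimately show False using assms(2) by simp
qed

text \<open>\<open>U\<close> is covered by its trace on the kernel and the discarded sets. If the
  trace were small, \<open>U\<close> would be small and itself discarded.\<close>

lemma not_small_kernel_Int:
  assumes "countable \<U>" "U \<in> \<U>" "U \<inter> kernel \<U> s \<noteq> {}"
  shows "\<not> small s (U \<inter> kernel \<U> s)"
proof
  assume "small s (U \<inter> kernel \<U> s)"
  moreover have "small s (\<Union>{U\<in>\<U>. small s U})"
    using assms(1) by (intro small_Union) auto
  ultimately have "small s ((U \<inter> kernel \<U> s) \<union> \<Union>{U\<in>\<U>. small s U})" by (rule small_Un)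
  then have "small s U" by (rule small_subset) (auto simp: kernel_def)
  then show False using assms(2,3) by (auto simp: kernel_def)
qed

lemma kernel_Int_upper_box_dim:
  assumes "countable \<U>" "U \<in> \<U>" "U \<inter> kernel \<U> s \<noteq> {}"
  shows "ereal s \<le> upper_box_dim (U \<inter> kernel \<U> s)"
proof (rule ccontr)
  assume "\<not> ?thesis"
  then have "small s (U \<inter> kernel \<U> s)"
    unfolding small_def by (intro exI[of _ "{U \<inter> kernel \<U> s}"]) (auto simp: not_le)
  then show False using not_small_kernel_Int[OF assms] by simp
qed

text \<open>Every smaller basic neighbourhood has a trace that is not small, hence infinite. Limit
  points provide room for the clusters of nodes in \<open>dense_spread_maps\<close>.\<close>

lemma kernel_Int_islimpt:
  assumes "countable \<U>" "\<And>U. U \<in> \<U> \<Longrightarrow> open U"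
    "\<And>V x. open V \<Longrightarrow> x \<in> V \<Longrightarrow> \<exists>U\<in>\<U>. x \<in> U \<and> U \<subseteq> V"
    and "U \<in> \<U>" "x \<in> U \<inter> kernel \<U> s"
  shows "x islimpt (U \<inter> kernel \<U> s)"
  unfolding islimpt_eq_infinite_ball
proof (intro allI impI)
  fix e :: real assume "e > 0"
  then obtain V where V: "V \<in> \<U>" "x \<in> V" "V \<subseteq> ball x e \<inter> U"
    using assms(3)[of "ball x e \<inter> U" x] assms(2)[OF assms(4)] assms(5) by auto
  then have "\<not> small s (V \<inter> kernel \<U> s)"
    using assms(1,5) by (intro not_small_kernel_Int) auto
  then have "infinite (V \<inter> kernel \<U> s)" using small_countable countable_finite by blast
  moreover have "V \<inter> kernel \<U> s \<subseteq> (U \<inter> kernel \<U> s) \<inter> ball x e" using V by auto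
  ultimately show "infinite ((U \<inter> kernel \<U> s) \<inter> ball x e)" using finite_subset by blast
qed

text \<open>If sets \<open>A i\<close> of upper box dimension below \<open>v\<close> cover the
  graph, the closed sets \<open>C i\<close> cover \<open>M\<close>, and by Baire one of them
  contains a relatively open piece. The graph over that piece lies in \<open>closure (A i)\<close>,
  whose packing numbers are at most those of \<open>A i\<close>; this contradicts the growth assumed
  at infinitely many scales.\<close>

lemma packing_dim_graph_ge:
  fixes f :: "'a::metric_space \<Rightarrow>\<^sub>C 'b::metric_space"
  assumes K: "compact (UNIV :: 'a set)" and M: "closed M" "M \<noteq> {}"
    and dim: "\<And>U v. open U \<Longrightarrow> U \<inter> M \<noteq> {} \<Longrightarrow> v < w \<Longrightarrow>
      frequently (\<lambda>n. 2 powr (real n * v) \<le> real (packing_number n (graph_on f (U \<inter> M)))) sequentially"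
  shows "ereal w \<le> packing_dim (graph_of f)"
proof (rule ccontr)
  assume "\<not> ?thesis"
  then obtain v where v: "packing_dim (graph_of f) < ereal v" "v < w"
    by (metis ereal_dense2 ereal_less(3) less_ereal.simps(1) not_le)
  obtain A where A: "graph_of f \<subseteq> (\<Union>i. A i)" "\<And>i::nat. upper_box_dim (A i) < ereal v"
    by (rule packing_dim_lessE[OF v(1)]) (rule that)
  let ?g = "\<lambda>x. (x, apply_bcontfun f x)"
  define C where "C i = {x \<in> M. ?g x \<in> closure (A i)}" for i
  let ?X = "top_of_set M"
  have clC: "closedin ?X (C i)" for i
  proof -
    have "C i = M \<inter> ?g -` closure (A i)" by (auto simp: C_def)
    then show ?thesis
      using continuous_closedin_preimage[OF continuous_on_graph_map closed_closure] by metis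
  qed
  have "\<exists>i. ?X interior_of (C i) \<noteq> {}"
  proof (rule ccontr)
    assume no: "\<not> ?thesis"
    have "compact M" using K M(1) by (metis closed_Int_compact inf_top.right_neutral)
    then have "compact_space ?X" by (simp add: compact_space_subtopology)
    then have "?X interior_of \<Union>(range C) = {}"
      using no clC
      by (intro Baire_category_alt disjI2) (auto simp: compact_imp_locally_compact_space compact_Hausdorff_imp_regular_space Hausdorff_space_subtopology)
    moreover have "\<Union>(range C) = topspace ?X"
    proof -
      have "M \<subseteq> \<Union>(range C)"
      proof
        fix x assume "x \<in> M"
        obtain i where "?g x \<in> A i" using A(1) unfolding graph_of_def by blast
        then show "x \<in> \<Union>(range C)" using \<open>x \<in> M\<close> closure_subset unfolding C_def by blast
      qed
      then show ?thesis by (auto simp: C_def)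
    qed
    ultimately show False using M(2) by (simp only: interior_of_topspace) simp
  qed
  then obtain i where i: "?X interior_of (C i) \<noteq> {}" by blast
  have "openin ?X (?X interior_of (C i))" by simp
  then obtain U where U: "open U" "?X interior_of (C i) = M \<inter> U"
    unfolding openin_open by blast
  have ne: "U \<inter> M \<noteq> {}" using U(2) i by auto
  have "U \<inter> M \<subseteq> C i" using U(2) interior_of_subset[of ?X "C i"] by auto
  then have sub: "graph_on f (U \<inter> M) \<subseteq> closure (A i)"
    by (auto simp: graph_on_def C_def)
  have tb: "totally_bdd (A i)" using upper_box_dim_finiteD[OF A(2)] by simp
  \<comment> \<open>A value strictly between \<open>v\<close> and \<open>w\<close> leaves an
    exponential gap, visible at any scale \<open>n > 0\<close>.\<close>
  define v' where "v' = (v + w) / 2"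
  have v': "v < v'" "v' < w" using v(2) by (auto simp: v'_def)
  have "frequently (\<lambda>n. 2 powr (real n * v') \<le> real (packing_number n (graph_on f (U \<inter> M)))) sequentially"
    by (rule dim[OF U(1) ne v'(2)])
  moreover have "eventually (\<lambda>n. real (packing_number n (A i)) \<le> 2 powr (real n * v)) sequentially"
    by (rule upper_box_dim_less_imp[OF A(2)])
  moreover have "eventually (\<lambda>n::nat. n > 0) sequentially" by (rule eventually_gt_at_top)
  ultimately have "frequently (\<lambda>n. 2 powr (real n * v') \<le> real (packing_number n (graph_on f (U \<inter> M)))
      \<and> (real (packing_number n (A i)) \<le> 2 powr (real n * v) \<and> n > 0)) sequentially"
    by (intro frequently_eventually_frequently eventually_conj)
  then obtain n where n: "2 powr (real n * v') \<le> real (packing_number n (graph_on f (U \<inter> M)))"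
      "real (packing_number n (A i)) \<le> 2 powr (real n * v)" "n > 0"
    using frequently_ex by blast
  have "packing_number n (graph_on f (U \<inter> M)) \<le> packing_number n (closure (A i))"
    by (rule packing_number_mono[OF totally_bdd_closure[OF tb] sub])
  also have "\<dots> \<le> packing_number n (A i)"
    by (rule packing_number_closure_le[OF totally_bdd_closure[OF tb]])
  finally have "2 powr (real n * v') \<le> 2 powr (real n * v)" using n(1,2) by linarith
  then show False using n(3) v'(1) by simp
qed

subsection \<open>The probe measure and the number of collisions\<close>

definition grid :: "nat \<Rightarrow> ('n::finite \<Rightarrow> nat) set" where
  "grid m = PiE UNIV (\<lambda>_. {..<m})"

lemma finite_grid [simp]: "finite (grid m)"
  unfolding grid_def by (intro finite_PiE) auto

lemma card_grid: "card (grid m :: ('n::finite \<Rightarrow> nat) set) = m ^ CARD('n)"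
  unfolding grid_def by (simp add: card_PiE)

lemma grid_less: "j \<in> grid m \<Longrightarrow> j c < m"
  by (auto simp: grid_def)

text \<open>Bound for the probability that two nodes with indices \<open>a\<close> and
  \<open>b\<close> in one direction stay close in that direction. At equal indices only the trivial
  bound 1 is available.\<close>

definition gap_weight :: "nat \<Rightarrow> nat \<Rightarrow> real" where
  "gap_weight a b = (if a = b then 1 else 1 / \<bar>real a - real b\<bar>)"

lemma harm_le_ln:
  assumes "m > 0"
  shows "harm m \<le> 1 + ln (real m)"
proof -
  obtain k where k: "m = Suc k" using assms by (cases m) auto
  have "harm (Suc k) - ln (Suc k) \<le> harm (Suc 0) - ln (real (Suc 0))"
    using decseqD[OF decseq_harm_diff_ln, of 0 k] by simp
  then show ?thesis by (simp add: k harm_expand)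
qed

text \<open>The terms on each side of \<open>a\<close> form an initial part of the harmonic series,
  and \<open>ln m \<le> n\<close>. Hence the loss is only polynomial in the scale.\<close>

lemma sum_gap_weight:
  assumes a: "a < m" and m: "m \<le> 2 ^ n"
  shows "(\<Sum>b<m. gap_weight a b) \<le> 3 + 2 * real n"
proof -
  have inv: "harm m = (\<Sum>k=1..m. 1 / real k)" by (simp add: harm_def inverse_eq_divide)
  have left: "(\<Sum>b<a. gap_weight a b) \<le> harm m"
  proof -
    have "(\<Sum>b<a. gap_weight a b) = (\<Sum>k\<in>(\<lambda>b. a - b) ` {..<a}. 1 / real k)"
      by (subst sum.reindex) (auto simp: inj_on_def gap_weight_def of_nat_diff intro!: sum.cong)
    also have "\<dots> \<le> harm m" unfolding inv using a by (intro sum_mono2) auto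
    finally show ?thesis .
  qed
  have right: "(\<Sum>b\<in>{a<..<m}. gap_weight a b) \<le> harm m"
  proof -
    have "(\<Sum>b\<in>{a<..<m}. gap_weight a b) = (\<Sum>k\<in>(\<lambda>b. b - a) ` {a<..<m}. 1 / real k)"
      by (subst sum.reindex) (auto simp: inj_on_def gap_weight_def of_nat_diff intro!: sum.cong)
    also have "\<dots> \<le> harm m" unfolding inv using a by (intro sum_mono2) auto
    finally show ?thesis .
  qed
  have "{..<m} = {..<a} \<union> insert a {a<..<m}" using a by auto
  moreover have "sum (gap_weight a) ({..<a} \<union> insert a {a<..<m}) = sum (gap_weight a) {..<a} + sum (gap_weight a) (insert a {a<..<m})"
    by (rule sum.union_disjoint) auto
  ultimately have "(\<Sum>b<m. gap_weight a b) = (\<Sum>b<a. gap_weight a b) + (gap_weight a a + (\<Sum>b\<in>{a<..<m}. gap_weight a b))"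
    by simp
  also have "\<dots> \<le> harm m + (1 + harm m)"
    using left right by (intro add_mono) (auto simp: gap_weight_def)
  also have "harm m \<le> 1 + real n"
  proof -
    have "ln (real m) \<le> ln (2 ^ n)" using m a by (subst ln_le_cancel_iff) (auto simp: numeral_power_le_of_nat_cancel_iff simp flip: of_nat_le_iff)
    also have "\<dots> = real n * ln 2" by (simp add: ln_realpow)
    also have "\<dots> \<le> real n * 1" using ln_le_minus_one[of 2] by (intro mult_left_mono) auto
    finally show ?thesis using harm_le_ln[of m] a by simp
  qed
  finally show ?thesis by simp
qed

text \<open>The sum of a product over a product set factors into one-dimensional sums.\<close>

lemma sum_grid_weight:
  assumes j: "j \<in> (grid m :: ('n::finite \<Rightarrow> nat) set)" and m: "m \<le> 2 ^ n"
  shows "(\<Sum>j'\<in>grid m. \<Prod>c\<in>UNIV. gap_weight (j c) (j' c)) \<le> (3 + 2 * real n) ^ CARD('n)"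
proof -
  have "(\<Sum>j'\<in>grid m. \<Prod>c\<in>UNIV. gap_weight (j c) (j' c)) = (\<Prod>c\<in>UNIV. \<Sum>b<m. gap_weight (j c) b)"
    unfolding grid_def by (subst prod_sum_PiE) auto
  also have "\<dots> \<le> (\<Prod>c\<in>(UNIV::'n set). 3 + 2 * real n)"
    using grid_less[OF j] sum_gap_weight[OF _ m]
    by (intro prod_mono conjI sum_nonneg) (auto simp: gap_weight_def)
  finally show ?thesis by simp
qed

section \<open>The uniform measure on the unit cube\<close>

definition cube_measure :: "(real ^ 'n) measure" where
  "cube_measure = uniform_measure lborel (cbox 0 1)"

lemma sets_cube_measure [simp, measurable_cong]: "sets cube_measure = sets borel"
  by (simp add: cube_measure_def)

lemma space_cube_measure [simp]: "space cube_measure = UNIV"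
  by (simp add: cube_measure_def)

lemma measure_unit_cube: "measure lborel (cbox 0 1 :: (real ^ 'n) set) = 1"
proof -
  have "(cbox 0 1 :: (real ^ 'n) set) \<noteq> {}"
    by (simp add: interval_ne_empty_cart)
  then show ?thesis by (simp add: content_cbox_cart)
qed

lemma prob_space_cube_measure: "prob_space (cube_measure :: (real ^ 'n) measure)"
  unfolding cube_measure_def
proof (rule prob_space_uniform_measure)
  show "emeasure lborel (cbox 0 1 :: (real ^ 'n) set) \<noteq> 0"
    using measure_unit_cube[where 'n = 'n] by (auto simp: measure_def)
qed (simp add: emeasure_lborel_cbox_eq)

text \<open>The condition confines \<open>t $ c\<close> to an interval of length
  \<open>2 * r / \<bar>\<alpha> c\<bar>\<close>. Coordinates with \<open>w c = 1\<close> keep the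
  full unit side instead, so the set lies in a box whose sides are at most
  \<open>w c\<close>.\<close>

lemma measure_cube_slab:
  fixes \<alpha> \<beta> w :: "'n::finite \<Rightarrow> real"
  assumes w: "\<And>c. w c = 1 \<or> \<alpha> c \<noteq> 0 \<and> 2 * r / \<bar>\<alpha> c\<bar> \<le> w c" and r: "r \<ge> 0"
  shows "measure cube_measure {t :: real ^ 'n. \<forall>c. \<bar>t $ c * \<alpha> c - \<beta> c\<bar> \<le> r} \<le> (\<Prod>c\<in>UNIV. w c)"
proof -
  let ?S = "{t :: real ^ 'n. \<forall>c. \<bar>t $ c * \<alpha> c - \<beta> c\<bar> \<le> r}"
  define a :: "real ^ 'n" where "a = (\<chi> c. if w c = 1 then 0 else \<beta> c / \<alpha> c - r / \<bar>\<alpha> c\<bar>)"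
  define b :: "real ^ 'n" where "b = (\<chi> c. if w c = 1 then 1 else \<beta> c / \<alpha> c + r / \<bar>\<alpha> c\<bar>)"
  have ab: "a $ c \<le> b $ c" for c using r by (simp add: a_def b_def)
  have width: "b $ c - a $ c \<le> w c" for c
    using w[of c] by (auto simp: a_def b_def)
  have sub: "cbox 0 1 \<inter> ?S \<subseteq> cbox a b"
  proof
    fix t assume t: "t \<in> cbox 0 1 \<inter> ?S"
    have "a $ c \<le> t $ c \<and> t $ c \<le> b $ c" for c
    proof (cases "w c = 1")
      case True
      then show ?thesis using t by (auto simp: a_def b_def mem_box_cart)
    next
      case False
      then have \<alpha>: "\<alpha> c \<noteq> 0" using w[of c] by auto
      have "\<bar>t $ c - \<beta> c / \<alpha> c\<bar> = \<bar>t $ c * \<alpha> c - \<beta> c\<bar> / \<bar>\<alpha> c\<bar>"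
        using \<alpha> by (simp add: abs_divide[symmetric] diff_divide_distrib)
      also have "\<dots> \<le> r / \<bar>\<alpha> c\<bar>" using t by (intro divide_right_mono) auto
      finally show ?thesis using False by (simp add: a_def b_def abs_le_iff)
    qed
    then show "t \<in> cbox a b" by (simp add: mem_box_cart)
  qed
  have "measure cube_measure ?S = measure lborel (cbox 0 1 \<inter> ?S)"
  proof -
    have "?S \<in> sets borel"
      by (intro borel_closed closed_Collect_all closed_Collect_le continuous_intros)
    then show ?thesis
      unfolding cube_measure_def using measure_unit_cube[where 'n = 'n]
      by (subst measure_uniform_measure) (auto simp: measure_def)
  qed
  also have "\<dots> \<le> measure lborel (cbox a b)"
    by (rule measure_mono_fmeasurable[OF sub]) auto
  also have "\<dots> = (\<Prod>c\<in>UNIV. b $ c - a $ c)"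
    using ab by (intro content_cbox_cart) (auto simp: interval_ne_empty_cart)
  also have "\<dots> \<le> (\<Prod>c\<in>UNIV. w c)" using width ab by (intro prod_mono) auto
  finally show ?thesis .
qed

section \<open>Random maps obtained by stretching the coordinates of a fixed map\<close>

definition coord :: "'n::finite \<Rightarrow> ('a::topological_space \<Rightarrow>\<^sub>C (real ^ 'n)) \<Rightarrow> 'a \<Rightarrow>\<^sub>C (real ^ 'n)" where
  "coord c F = Bcontfun (\<lambda>x. (apply_bcontfun F x $ c) *\<^sub>R axis c 1)"

lemma apply_coord:
  fixes F :: "'a::topological_space \<Rightarrow>\<^sub>C (real ^ 'n)"
  shows "apply_bcontfun (coord c F) x = (apply_bcontfun F x $ c) *\<^sub>R axis c 1"
proof -
  have "(\<lambda>x. (apply_bcontfun F x $ c) *\<^sub>R axis c 1 :: real ^ 'n) \<in> bcontfun"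
  proof (rule bcontfun_normI)
    show "continuous_on UNIV (\<lambda>x. (apply_bcontfun F x $ c) *\<^sub>R axis c 1 :: real ^ 'n)"
      by (intro continuous_intros continuous_on_apply_bcontfun)
    show "norm ((apply_bcontfun F x $ c) *\<^sub>R axis c 1 :: real ^ 'n) \<le> norm F" for x
      using component_le_norm_cart[of "F x" c] norm_bounded[of F x] by (simp add: norm_axis_1)
  qed
  then show ?thesis by (simp add: coord_def Bcontfun_inverse)
qed

text \<open>A linear combination of fixed maps makes continuity in \<open>t\<close> immediate;
  \<open>stretch_component\<close> gives the pointwise form.\<close>

definition stretch :: "('a::topological_space \<Rightarrow>\<^sub>C (real ^ 'n)) \<Rightarrow> real ^ 'n \<Rightarrow> 'a \<Rightarrow>\<^sub>C (real ^ 'n)" where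
  "stretch F t = (\<Sum>c\<in>UNIV. (t $ c) *\<^sub>R coord c F)"

lemma apply_bcontfun_sum:
  "apply_bcontfun (\<Sum>i\<in>I. f i) x = (\<Sum>i\<in>I. apply_bcontfun (f i :: 'a::topological_space \<Rightarrow>\<^sub>C 'b::real_normed_vector) x)"
  by (induction I rule: infinite_finite_induct) auto

lemma stretch_component: "apply_bcontfun (stretch F t) x $ c = t $ c * apply_bcontfun F x $ c"
proof -
  have "apply_bcontfun (stretch F t) x $ c = (\<Sum>i\<in>UNIV. if i = c then t $ c * apply_bcontfun F x $ c else 0)"
    unfolding stretch_def apply_bcontfun_sum sum_component
    by (intro sum.cong) (auto simp: apply_coord axis_def)
  then show ?thesis by simp
qed

lemma continuous_on_stretch: "continuous_on S (stretch F)"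
  unfolding stretch_def by (intro continuous_intros)

lemma continuous_on_eval: "continuous_on S (\<lambda>f :: 'a::topological_space \<Rightarrow>\<^sub>C 'b::metric_space. apply_bcontfun f x)"
  unfolding continuous_on_iff using dist_bounded le_less_trans by metis

text \<open>Closeness is asked coordinatewise, so that the corresponding parameters \<open>t\<close>
  form a product of slabs. Closeness in the Euclidean norm implies it.\<close>

definition near :: "real \<Rightarrow> 'a::topological_space \<Rightarrow> 'a \<Rightarrow> ('a \<Rightarrow>\<^sub>C (real ^ 'n)) set" where
  "near r u v = {f. \<forall>c. \<bar>apply_bcontfun f u $ c - apply_bcontfun f v $ c\<bar> \<le> r}"

lemma closed_near: "closed (near r u v)"
  unfolding near_def
  by (intro closed_Collect_all closed_Collect_le continuous_intros continuous_on_eval)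

text \<open>Only nodes at the same \<open>x\<close> are compared, since nodes at different
  \<open>x\<close> will be apart in the domain already. As a sum of indicators of closed sets, the
  count is Borel and its expectation splits into probabilities.\<close>

definition collisions :: "nat \<Rightarrow> nat \<Rightarrow> 'i set \<Rightarrow> ('i \<Rightarrow> ('n \<Rightarrow> nat) \<Rightarrow> 'a::topological_space) \<Rightarrow> ('a \<Rightarrow>\<^sub>C (real ^ 'n)) \<Rightarrow> real" where
  "collisions n m X y f = (\<Sum>x\<in>X. \<Sum>j\<in>grid m. \<Sum>j'\<in>grid m. indicator (near ((1/2) ^ n) (y x j) (y x j')) f)"

lemma borel_measurable_collisions [measurable]: "collisions n m X y \<in> borel_measurable borel"
  unfolding collisions_def
  by (intro borel_measurable_sum borel_measurable_indicator borel_closed closed_near)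

lemma collisions_nonneg: "0 \<le> collisions n m X y f"
  unfolding collisions_def by (intro sum_nonneg) auto

text \<open>The factor 2 makes the slab of width \<open>2 * (1/2)^n / \<bar>\<alpha>\<bar>\<close> in \<open>measure_cube_slab\<close> at most \<open>gap_weight\<close>.\<close>

definition spread :: "nat \<Rightarrow> nat \<Rightarrow> 'i set \<Rightarrow> ('i \<Rightarrow> ('n::finite \<Rightarrow> nat) \<Rightarrow> 'a::topological_space) \<Rightarrow> ('a \<Rightarrow>\<^sub>C (real ^ 'n)) \<Rightarrow> bool" where
  "spread n m X y F \<longleftrightarrow> (\<forall>x\<in>X. \<forall>j\<in>grid m. \<forall>j'\<in>grid m. \<forall>c. j c \<noteq> j' c \<longrightarrow>
     2 * (1/2) ^ n * \<bar>real (j c) - real (j' c)\<bar> < \<bar>apply_bcontfun F (y x j) $ c - apply_bcontfun F (y x j') $ c\<bar>)"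

text \<open>The map \<open>g\<close> enters only through the offsets \<open>\<beta>\<close>, which
  do not affect the width of the slabs. The bound is therefore uniform over all translates, as
  shyness demands.\<close>

lemma measure_stretch_near:
  fixes F g :: "'a::topological_space \<Rightarrow>\<^sub>C (real ^ 'n)"
  assumes F: "spread n m X y F" and x: "x \<in> X" "j \<in> grid m" "j' \<in> grid m"
  shows "measure cube_measure {t. stretch F t - g \<in> near ((1/2) ^ n) (y x j) (y x j')} \<le> (\<Prod>c\<in>UNIV. gap_weight (j c) (j' c))"
proof -
  define \<alpha> where "\<alpha> c = apply_bcontfun F (y x j) $ c - apply_bcontfun F (y x j') $ c" for c
  define \<beta> where "\<beta> c = apply_bcontfun g (y x j) $ c - apply_bcontfun g (y x j') $ c" for c
  have "{t. stretch F t - g \<in> near ((1/2) ^ n) (y x j) (y x j')} = {t. \<forall>c. \<bar>t $ c * \<alpha> c - \<beta> c\<bar> \<le> (1/2) ^ n}"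
    by (simp add: near_def stretch_component \<alpha>_def \<beta>_def algebra_simps)
  moreover have "measure cube_measure {t :: real ^ 'n. \<forall>c. \<bar>t $ c * \<alpha> c - \<beta> c\<bar> \<le> (1/2) ^ n} \<le> (\<Prod>c\<in>UNIV. gap_weight (j c) (j' c))"
  proof (rule measure_cube_slab)
    fix c
    show "gap_weight (j c) (j' c) = 1 \<or> \<alpha> c \<noteq> 0 \<and> 2 * (1/2) ^ n / \<bar>\<alpha> c\<bar> \<le> gap_weight (j c) (j' c)"
    proof (cases "j c = j' c")
      case False
      define k where "k = \<bar>real (j c) - real (j' c)\<bar>"
      have k: "k > 0" using False by (simp add: k_def)
      have lt: "2 * (1/2) ^ n * k < \<bar>\<alpha> c\<bar>"
        using F x False unfolding spread_def \<alpha>_def k_def by blast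
      have "0 \<le> 2 * (1/2) ^ n * k" using k by simp
      then have pos: "\<bar>\<alpha> c\<bar> > 0" using lt by linarith
      have "2 * (1/2) ^ n / \<bar>\<alpha> c\<bar> \<le> 1 / k"
        using lt k pos by (simp add: divide_le_eq pos_le_divide_eq)
      then show ?thesis using pos False by (simp add: gap_weight_def k_def)
    qed (simp add: gap_weight_def)
  qed simp
  ultimately show ?thesis by simp
qed

lemma measurable_stretch_diff [measurable]: "(\<lambda>t. stretch F t - g) \<in> borel_measurable cube_measure"
proof -
  have "continuous_on UNIV (\<lambda>t. stretch F t - g)"
    by (intro continuous_intros continuous_on_stretch)
  then have "(\<lambda>t. stretch F t - g) \<in> borel_measurable borel" by (rule borel_measurable_continuous_onI)
  then show ?thesis by (simp cong: measurable_cong_sets)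
qed

lemma integral_collisions_le:
  fixes F g :: "'a::topological_space \<Rightarrow>\<^sub>C (real ^ 'n)"
  assumes F: "spread n m X y F" and X: "finite X" and m: "m \<le> 2 ^ n"
  shows "integrable cube_measure (\<lambda>t. collisions n m X y (stretch F t - g))"
    and "(\<integral>t. collisions n m X y (stretch F t - g) \<partial>cube_measure) \<le> card X * m ^ CARD('n) * (3 + 2 * real n) ^ CARD('n)"
proof -
  interpret prob_space "cube_measure :: (real ^ 'n) measure" by (rule prob_space_cube_measure)
  let ?I = "\<lambda>x j j' t. indicator (near ((1/2) ^ n) (y x j) (y x j')) (stretch F t - g) :: real"
  let ?S = "\<lambda>x j j'. {t. stretch F t - g \<in> near ((1/2) ^ n) (y x j) (y x j')}"
  have I: "?I x j j' t = indicator (?S x j j') t" for x j j' t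
    by (simp add: indicator_def)
  have S: "?S x j j' \<in> sets cube_measure" for x j j'
    using measurable_sets[OF measurable_stretch_diff borel_closed[OF closed_near], of F g] by (simp add: vimage_def)
  have int: "integrable cube_measure (?I x j j')" for x j j'
    unfolding I using S by (intro integrable_real_indicator) (auto simp: emeasure_eq_measure)
  show "integrable cube_measure (\<lambda>t. collisions n m X y (stretch F t - g))"
    unfolding collisions_def by (intro Bochner_Integration.integrable_sum int)
  have "(\<integral>t. collisions n m X y (stretch F t - g) \<partial>cube_measure) =
      (\<Sum>x\<in>X. \<Sum>j\<in>grid m. \<Sum>j'\<in>grid m. measure cube_measure (?S x j j'))"
    unfolding collisions_def
    by (subst Bochner_Integration.integral_sum, intro Bochner_Integration.integrable_sum int, intro sum.cong refl)+
       (simp add: I S)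
  also have "\<dots> \<le> (\<Sum>x\<in>X. \<Sum>j\<in>(grid m :: ('n \<Rightarrow> nat) set). \<Sum>j'\<in>grid m. \<Prod>c\<in>UNIV. gap_weight (j c) (j' c))"
    by (intro sum_mono measure_stretch_near[OF F])
  also have "\<dots> \<le> (\<Sum>x\<in>X. \<Sum>j\<in>(grid m :: ('n \<Rightarrow> nat) set). (3 + 2 * real n) ^ CARD('n))"
    by (intro sum_mono sum_grid_weight m)
  also have "\<dots> = card X * m ^ CARD('n) * (3 + 2 * real n) ^ CARD('n)"
    by (simp add: card_grid)
  finally show "(\<integral>t. collisions n m X y (stretch F t - g) \<partial>cube_measure) \<le> card X * m ^ CARD('n) * (3 + 2 * real n) ^ CARD('n)" .
qed

text \<open>Markov's inequality. The number of nodes cancels, leaving a bound that tends to 0 when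
  \<open>L\<close> grows exponentially in \<open>n\<close>.\<close>

lemma measure_many_collisions_le:
  fixes F g :: "'a::topological_space \<Rightarrow>\<^sub>C (real ^ 'n)" and L :: real
  assumes F: "spread n m X y F" and X: "finite X" "X \<noteq> {}" and m: "0 < m" "m \<le> 2 ^ n" and L: "L > 0"
  shows "measure cube_measure {t. card X * m ^ CARD('n) * L \<le> collisions n m X y (stretch F t - g)} \<le> (3 + 2 * real n) ^ CARD('n) / L"
proof -
  have V: "real (card X * m ^ CARD('n)) > 0" using X m by (simp add: card_gt_0_iff)
  have "measure cube_measure {t \<in> space cube_measure. card X * m ^ CARD('n) * L \<le> collisions n m X y (stretch F t - g)}
     \<le> (\<integral>t. collisions n m X y (stretch F t - g) \<partial>cube_measure) / (card X * m ^ CARD('n) * L)"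
    using V L by (intro integral_Markov_inequality_measure[where A = "{}"] integral_collisions_le[OF F X(1) m(2)])
      (auto simp: collisions_nonneg)
  also have "\<dots> \<le> card X * m ^ CARD('n) * (3 + 2 * real n) ^ CARD('n) / (card X * m ^ CARD('n) * L)"
    using V L by (intro divide_right_mono integral_collisions_le(2)[OF F X(1) m(2)]) auto
  also have "\<dots> = (3 + 2 * real n) ^ CARD('n) / L"
    using X m(1) L by (simp add: card_gt_0_iff)
  finally show ?thesis by simp
qed

text \<open>Nodes whose graph points are \<open>(1/2) ^ n\<close>-close belong to the same
  \<open>x\<close> and form a collision. Few collisions thus give many separated points by
  \<open>packing_number_collisions\<close>, at the cost of one scale.\<close>

lemma packing_number_ge_of_collisions:
  fixes f :: "'a::metric_space \<Rightarrow>\<^sub>C (real ^ 'n)" and L :: real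
  assumes K: "compact (UNIV :: 'a set)" and X: "finite X" "X \<noteq> {}" and m: "0 < m"
    and y: "\<And>x j. x \<in> X \<Longrightarrow> j \<in> grid m \<Longrightarrow> y x j \<in> A"
    and sep: "\<And>x x' j j'. x \<in> X \<Longrightarrow> x' \<in> X \<Longrightarrow> x \<noteq> x' \<Longrightarrow> j \<in> grid m \<Longrightarrow> j' \<in> grid m \<Longrightarrow> (1/2) ^ n < dist (y x j) (y x' j')"
    and few: "collisions n m X y f \<le> card X * m ^ CARD('n) * L"
  shows "card X * m ^ CARD('n) \<le> L * packing_number (Suc n) (graph_on f A)"
proof -
  define V where "V = X \<times> (grid m :: ('n \<Rightarrow> nat) set)"
  define p where "p = (\<lambda>(x,j). (y x j, apply_bcontfun f (y x j)))"
  define N where "N = real (packing_number (Suc n) (graph_on f A))"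
  have cV: "card V = card X * m ^ CARD('n)" by (simp add: V_def card_cartesian_product card_grid)
  have V: "finite V" using X by (simp add: V_def)
  define W where "W = (SIGMA x:X. SIGMA j:grid m. {j'\<in>grid m. f \<in> near ((1/2) ^ n) (y x j) (y x j')})"
  have finW: "finite W" unfolding W_def using X by (intro finite_SigmaI) auto
  have cW: "real (card W) = collisions n m X y f"
  proof -
    have "real (card W) = (\<Sum>x\<in>X. \<Sum>j\<in>grid m. real (card {j'\<in>grid m. f \<in> near ((1/2) ^ n) (y x j) (y x j')}))"
      unfolding W_def using X by (simp add: card_SigmaI)
    also have "\<dots> = collisions n m X y f"
      unfolding collisions_def
      by (intro sum.cong refl) (simp add: indicator_def sum.If_cases Int_def)
    finally show ?thesis .
  qed
  let ?D = "{(v,w) \<in> V \<times> V. dist (p v) (p w) \<le> (1/2) ^ n}"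
  \<comment> \<open>Closeness forces equal \<open>x\<close>, so dropping the second copy of
    \<open>x\<close> embeds the close pairs into \<open>W\<close>.\<close>
  have D: "fst (fst q) = fst (snd q) \<and> (fst (fst q), snd (fst q), snd (snd q)) \<in> W" if q: "q \<in> ?D" for q
  proof -
    obtain x j x' j' where q': "q = ((x,j),(x',j'))" by (metis surj_pair)
    have mem: "x \<in> X" "x' \<in> X" "j \<in> grid m" "j' \<in> grid m"
      and d: "dist (p (x,j)) (p (x',j')) \<le> (1/2) ^ n" using q by (auto simp: q' V_def)
    have d1: "dist (y x j) (y x' j') \<le> (1/2) ^ n"
      using d dist_fst_le[of "p (x,j)" "p (x',j')"] by (simp add: p_def)
    have d2: "dist (apply_bcontfun f (y x j)) (apply_bcontfun f (y x' j')) \<le> (1/2) ^ n"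
      using d dist_snd_le[of "p (x,j)" "p (x',j')"] by (simp add: p_def)
    have xx: "x = x'" using sep[OF mem(1,2) _ mem(3,4)] d1 by (meson not_le)
    have "\<bar>apply_bcontfun f (y x j) $ c - apply_bcontfun f (y x j') $ c\<bar> \<le> (1/2) ^ n" for c
    proof -
      have "\<bar>apply_bcontfun f (y x j) $ c - apply_bcontfun f (y x j') $ c\<bar> \<le> dist (apply_bcontfun f (y x j)) (apply_bcontfun f (y x j'))"
        unfolding dist_norm using component_le_norm_cart[of "f (y x j) - f (y x j')" c] by simp
      then show ?thesis using d2 xx by simp
    qed
    then show ?thesis using mem xx by (simp add: q' W_def near_def)
  qed
  have "card ?D \<le> card W"
  proof (rule card_inj_on_le[OF _ _ finW])
    let ?h = "\<lambda>q. (fst (fst q), snd (fst q), snd (snd q))"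
    show "inj_on ?h ?D"
    proof (rule inj_onI)
      fix q q' assume q: "q \<in> ?D" "q' \<in> ?D" and eq: "?h q = ?h q'"
      show "q = q'"
        using conjunct1[OF D[OF q(1)]] conjunct1[OF D[OF q(2)]] eq by (intro prod_eqI) simp_all
    qed
    show "?h ` ?D \<subseteq> W" by (rule image_subsetI) (rule conjunct2[OF D])
  qed
  then have cD: "real (card ?D) \<le> real (card V) * L" using few cW cV by simp
  have "p ` V \<subseteq> graph_on f A" using y by (auto simp: p_def V_def graph_on_def)
  from packing_number_collisions[OF V totally_bdd_graph_on[OF K] this, of n]
  have "real ((card V)\<^sup>2) \<le> real (card ?D * packing_number (Suc n) (graph_on f A))"
    by (simp only: of_nat_le_iff)
  then have "real (card V) * real (card V) \<le> real (card ?D) * N"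
    by (simp add: N_def power2_eq_square)
  also have "\<dots> \<le> (real (card V) * L) * N" using cD by (intro mult_right_mono) (auto simp: N_def)
  finally have "real (card V) * real (card V) \<le> real (card V) * (L * N)" by (simp add: mult.assoc)
  moreover have "real (card V) > 0" using X m unfolding cV by (simp add: card_gt_0_iff)
  ultimately have "real (card V) \<le> L * N" by (simp only: mult_le_cancel_left_pos)
  then show ?thesis by (simp add: cV N_def)
qed

subsection \<open>Generic spread maps\<close>

text \<open>A sum of tents with disjoint supports: at most one is nonzero at any point, so the norm
  stays at most \<open>b\<close> however many values are prescribed.\<close>

lemma bcontfun_interpolation:
  fixes v :: "'a::metric_space \<Rightarrow> 'b::real_normed_vector"
  assumes Z: "finite Z" and v: "\<And>z. z \<in> Z \<Longrightarrow> norm (v z) \<le> b" and b: "0 \<le> b"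
  obtains h :: "'a \<Rightarrow>\<^sub>C 'b" where "\<And>z. z \<in> Z \<Longrightarrow> apply_bcontfun h z = v z" "norm h \<le> b"
proof -
  have "\<forall>z. \<exists>d>0. \<forall>w\<in>Z. w \<noteq> z \<longrightarrow> d \<le> dist z w"
    using finite_set_avoid[OF Z] by blast
  then obtain d where d: "\<And>z. d z > 0" "\<And>z w. w \<in> Z \<Longrightarrow> w \<noteq> z \<Longrightarrow> d z \<le> dist z w" by metis
  \<comment> \<open>With radius \<open>d z / 2\<close>, two overlapping tents would have centres
    closer than the larger of their two values of \<open>d\<close>.\<close>
  define \<phi> where "\<phi> z x = max 0 (1 - dist x z / (d z / 2))" for z x
  define h where "h x = (\<Sum>z\<in>Z. \<phi> z x *\<^sub>R v z)" for x
  have \<phi>0: "\<phi> z x = 0 \<longleftrightarrow> d z / 2 \<le> dist x z" for z x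
    using d(1)[of z] by (auto simp: \<phi>_def max_def field_simps)
  have \<phi>1: "0 \<le> \<phi> z x" "\<phi> z x \<le> 1" for z x
    using d(1)[of z] by (auto simp: \<phi>_def)
  have disj: "\<phi> w x = 0" if "z \<in> Z" "w \<in> Z" "w \<noteq> z" "\<phi> z x \<noteq> 0" for z w x
  proof (rule ccontr)
    assume "\<phi> w x \<noteq> 0"
    then have "dist x w < d w / 2" "dist x z < d z / 2" using that(4) \<phi>0 not_le by auto
    moreover have "dist z w \<le> dist x z + dist x w" by (rule dist_triangle3)
    ultimately show False using d(2)[OF that(2,3)] d(2)[OF that(1), of w] that(3) by (simp add: dist_commute)
  qed
  have single: "h x = \<phi> z x *\<^sub>R v z" if "z \<in> Z" "\<phi> z x \<noteq> 0" for z x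
  proof -
    have "h x = \<phi> z x *\<^sub>R v z + (\<Sum>w\<in>Z-{z}. \<phi> w x *\<^sub>R v w)"
      unfolding h_def using Z that(1) by (rule sum.remove)
    also have "(\<Sum>w\<in>Z-{z}. \<phi> w x *\<^sub>R v w) = 0"
      using disj[OF that(1) _ _ that(2)] by (intro sum.neutral) simp
    finally show ?thesis by simp
  qed
  have bound: "norm (h x) \<le> b" for x
  proof (cases "\<exists>z\<in>Z. \<phi> z x \<noteq> 0")
    case True
    then obtain z where z: "z \<in> Z" "\<phi> z x \<noteq> 0" by blast
    have "norm (h x) = \<phi> z x * norm (v z)" using single[OF z] \<phi>1(1) by simp
    also have "\<dots> \<le> 1 * b" using v[OF z(1)] \<phi>1 b by (intro mult_mono) auto
    finally show ?thesis by simp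
  next
    case False
    then have "h x = 0" unfolding h_def by (intro sum.neutral) simp
    then show ?thesis using b by simp
  qed
  have "continuous_on UNIV h"
    unfolding h_def \<phi>_def by (intro continuous_intros) (use d(1) in \<open>simp add: less_imp_neq[symmetric]\<close>)
  then have h: "h \<in> bcontfun" using bound by (rule bcontfun_normI)
  show thesis
  proof
    show "apply_bcontfun (Bcontfun h) z = v z" if "z \<in> Z" for z
    proof -
      have "\<phi> z z = 1" by (simp add: \<phi>_def)
      then show ?thesis using single[OF that, of z] h by (simp add: Bcontfun_inverse)
    qed
    show "norm (Bcontfun h) \<le> b"
      using h bound by (intro norm_bound) (simp add: Bcontfun_inverse)
  qed
qed

text \<open>These conditions do not mention the map, so openness concerns \<open>spread\<close>
  alone. The inequality on \<open>(3 + 2 * real n) ^ CARD('n)\<close> makes the bound of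
  \<open>measure_many_collisions_le\<close> at most \<open>\<epsilon>\<close> for
  \<open>L = 2 powr (real n * \<epsilon>)\<close>.\<close>

definition arrangement :: "'a::metric_space set \<Rightarrow> real \<Rightarrow> real \<Rightarrow> nat \<Rightarrow> nat \<Rightarrow> 'a set \<Rightarrow> ('a \<Rightarrow> ('n::finite \<Rightarrow> nat) \<Rightarrow> 'a) \<Rightarrow> bool" where
  "arrangement A s \<epsilon> n m X y \<longleftrightarrow>
     finite X \<and> X \<noteq> {} \<and> 2 powr (real n * (s - \<epsilon>)) \<le> real (card X) \<and>
     2 powr (real n * (1 - \<epsilon>)) \<le> real m \<and> m \<le> 2 ^ n \<and>
     (3 + 2 * real n) ^ CARD('n) \<le> \<epsilon> * 2 powr (real n * \<epsilon>) \<and>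
     (\<forall>x\<in>X. \<forall>j\<in>grid m. y x j \<in> A) \<and>
     (\<forall>x\<in>X. \<forall>x'\<in>X. \<forall>j\<in>grid m. \<forall>j'\<in>grid m. x \<noteq> x' \<longrightarrow> (1/2) ^ n < dist (y x j) (y x' j'))"

text \<open>One index \<open>k\<close> controls both the scale and the loss; membership for all
  \<open>k\<close> gives arbitrarily fine scales with vanishing loss.\<close>

definition spread_maps :: "'a::metric_space set \<Rightarrow> real \<Rightarrow> nat \<Rightarrow> ('a \<Rightarrow>\<^sub>C (real ^ 'n)) set" where
  "spread_maps A s k = {F. \<exists>n m X y. k \<le> n \<and> arrangement A s (1 / Suc k) n m X y \<and> spread n m X y F}"

text \<open>Only finitely many strict inequalities between point evaluations occur, and these are
  continuous in the uniform metric.\<close>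

lemma open_spread:
  assumes "finite X"
  shows "open {F :: 'a::metric_space \<Rightarrow>\<^sub>C (real ^ 'n). spread n m X y F}"
proof -
  let ?S = "\<lambda>x j j' c. {F :: 'a \<Rightarrow>\<^sub>C (real ^ 'n). j c \<noteq> j' c \<longrightarrow>
     2 * (1/2) ^ n * \<bar>real (j c) - real (j' c)\<bar> < \<bar>apply_bcontfun F (y x j) $ c - apply_bcontfun F (y x j') $ c\<bar>}"
  have "{F :: 'a \<Rightarrow>\<^sub>C (real ^ 'n). spread n m X y F} = (\<Inter>x\<in>X. \<Inter>j\<in>grid m. \<Inter>j'\<in>grid m. \<Inter>c. ?S x j j' c)"
    by (auto simp: spread_def)
  moreover have "open (?S x j j' c)" for x j j' c
    by (intro open_Collect_imp open_Collect_less continuous_intros continuous_on_eval) simp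
  ultimately show ?thesis
    using assms by (simp add: open_INT)
qed

lemma open_spread_maps: "open (spread_maps A s k :: ('a::metric_space \<Rightarrow>\<^sub>C (real ^ 'n)) set)"
proof -
  have "spread_maps A s k = (\<Union>(n, m, X, y) \<in> {(n, m, X, y). k \<le> n \<and> arrangement A s (1 / Suc k) n m X y}.
      {F :: 'a \<Rightarrow>\<^sub>C (real ^ 'n). spread n m X y F})"
    unfolding spread_maps_def by blast
  also have "open \<dots>"
    by (intro open_UN) (auto simp: arrangement_def intro: open_spread)
  finally show ?thesis .
qed

text \<open>The loss of \<open>\<epsilon>\<close> in the exponent of \<open>m\<close> makes the
  total width \<open>3 * (1/2) ^ n * m\<close> of a grid tend to 0, so that a small perturbation can
  create it.\<close>

lemma choose_scale:
  fixes \<epsilon> \<delta> :: real and d k :: nat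
  assumes "\<epsilon> > 0" "\<delta> > 0"
  shows "eventually (\<lambda>n. k \<le> n \<and> (3 + 2 * real n) ^ d \<le> \<epsilon> * 2 powr (real n * \<epsilon>) \<and>
     (\<exists>m::nat. 2 powr (real n * (1 - \<epsilon>)) \<le> real m \<and> m \<le> 2 ^ n \<and> real d * (3 * (1/2) ^ n * real m) \<le> \<delta>)) sequentially"
proof -
  have 1: "eventually (\<lambda>n. (3 + 2 * real n) ^ d \<le> \<epsilon> * 2 powr (real n * \<epsilon>)) sequentially"
    using assms by real_asymp
  have "(\<lambda>n. 2 powr (- (real n * \<epsilon>))) \<longlonglongrightarrow> 0"
    using assms by real_asymp
  moreover have "(\<lambda>n. 2 powr (- real n)) \<longlonglongrightarrow> (0::real)"
    by real_asymp
  ultimately have lim: "(\<lambda>n. 2 powr (- (real n * \<epsilon>)) + 2 powr (- real n)) \<longlonglongrightarrow> 0"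
    using tendsto_add by fastforce
  have 2: "eventually (\<lambda>n. 2 powr (- (real n * \<epsilon>)) + 2 powr (- real n) \<le> 1) sequentially"
    using order_tendstoD(2)[OF lim, of 1] by (auto elim: eventually_mono)
  have "(\<lambda>n. real d * (3 * (2 powr (- (real n * \<epsilon>)) + 2 powr (- real n)))) \<longlonglongrightarrow> real d * (3 * 0)"
    by (intro tendsto_intros lim)
  then have 3: "eventually (\<lambda>n. real d * (3 * (2 powr (- (real n * \<epsilon>)) + 2 powr (- real n))) \<le> \<delta>) sequentially"
    by (rule eventually_mono[OF order_tendstoD(2)[where a = \<delta>]]) (use assms in auto)
  show ?thesis
    using 1 2 3 eventually_ge_at_top[of k]
  proof eventually_elim
    case (elim n)
    define m where "m = nat \<lceil>2 powr (real n * (1 - \<epsilon>))\<rceil>"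
    have m1: "2 powr (real n * (1 - \<epsilon>)) \<le> real m" unfolding m_def by linarith
    have "0 \<le> 2 powr (real n * (1 - \<epsilon>))" by simp
    then have "real m \<le> 2 powr (real n * (1 - \<epsilon>)) + 1" unfolding m_def by linarith
    \<comment> \<open>Factoring out \<open>2 powr real n\<close> bounds \<open>m / 2 ^ n\<close> by
      a null sequence, which gives both \<open>m \<le> 2 ^ n\<close> and the width estimate.\<close>
    also have "\<dots> = 2 powr real n * (2 powr (- (real n * \<epsilon>)) + 2 powr (- real n))"
      by (simp add: distrib_left powr_add[symmetric] right_diff_distrib)
    finally have m2: "real m \<le> 2 powr real n * (2 powr (- (real n * \<epsilon>)) + 2 powr (- real n))" .
    also have "\<dots> \<le> 2 powr real n * 1" using elim(2) by (intro mult_left_mono) auto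
    finally have "real m \<le> real (2 ^ n)" by (simp add: powr_realpow)
    then have m3: "m \<le> 2 ^ n" by (simp only: of_nat_le_iff)
    have half: "(1/2::real) ^ n * 2 powr real n = 1"
      by (simp add: powr_realpow power_mult_distrib[symmetric])
    have "(1/2) ^ n * real m \<le> (1/2) ^ n * (2 powr real n * (2 powr (- (real n * \<epsilon>)) + 2 powr (- real n)))"
      using m2 by (intro mult_left_mono) auto
    also have "\<dots> = 2 powr (- (real n * \<epsilon>)) + 2 powr (- real n)"
      unfolding mult.assoc[symmetric] half by simp
    finally have "real d * (3 * ((1/2) ^ n * real m)) \<le> real d * (3 * (2 powr (- (real n * \<epsilon>)) + 2 powr (- real n)))"
      by (intro mult_left_mono) auto
    then have "real d * (3 * (1/2) ^ n * real m) \<le> \<delta>" using elim(3) by (simp add: mult.assoc)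
    then show ?case using elim m1 m3 by (meson order_trans)
  qed
qed

text \<open>Around each point \<open>x\<close> of a maximal separated set, where \<open>F0\<close>
  is nearly constant, distinct nodes are chosen in \<open>A\<close>, and \<open>F0\<close> is
  perturbed to take the value \<open>F0 x + lift j\<close> at node \<open>j\<close>. This costs
  \<open>e / 4\<close> for the variation of \<open>F0\<close> and \<open>e / 4\<close> for the
  grid.\<close>

lemma dense_spread_maps:
  fixes A :: "'a::metric_space set" and F0 :: "'a \<Rightarrow>\<^sub>C (real ^ 'n)"
  assumes A: "A \<noteq> {}" "totally_bdd A" "\<And>x. x \<in> A \<Longrightarrow> x islimpt A" "ereal s \<le> upper_box_dim A" and e: "e > 0"
  shows "\<exists>F\<in>spread_maps A s k. dist F F0 < e"
proof -
  define \<epsilon> where "\<epsilon> = 1 / real (Suc k)"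
  have \<epsilon>: "\<epsilon> > 0" by (simp add: \<epsilon>_def)
  have fr: "frequently (\<lambda>n. 2 powr (real n * (s - \<epsilon>)) \<le> real (packing_number n A)) sequentially"
    using \<epsilon> by (intro upper_box_dim_ge_imp[OF A(4,1,2)]) simp
  have "e / 4 > 0" using e by simp
  from frequently_ex[OF frequently_eventually_frequently[OF fr choose_scale[OF \<epsilon> this, of k "CARD('n)"]]]
  obtain n m where n: "2 powr (real n * (s - \<epsilon>)) \<le> real (packing_number n A)" "k \<le> n"
      "(3 + 2 * real n) ^ CARD('n) \<le> \<epsilon> * 2 powr (real n * \<epsilon>)"
    and m: "2 powr (real n * (1 - \<epsilon>)) \<le> real m" "m \<le> 2 ^ n" "real CARD('n) * (3 * (1/2) ^ n * real m) \<le> e / 4"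
    by auto
  obtain X where X: "finite X" "X \<subseteq> A" "separated n X" "card X = packing_number n A"
    by (rule packing_number_attained[OF A(2), of n]) (rule that)
  obtain \<delta> where \<delta>: "\<delta> > 0"
    "\<And>x y x' y'. x \<in> X \<Longrightarrow> y \<in> X \<Longrightarrow> x \<noteq> y \<Longrightarrow> dist x x' < \<delta> \<Longrightarrow> dist y y' < \<delta> \<Longrightarrow> dist x' y' > (1/2) ^ n"
    using separated_near[OF X(1,3)] by blast
  let ?G = "grid m :: ('n \<Rightarrow> nat) set"
  have "\<exists>h. inj_on h ?G \<and> (\<forall>j\<in>?G. h j \<in> A \<and> dist x (h j) < \<delta> \<and> dist (apply_bcontfun F0 (h j)) (apply_bcontfun F0 x) < e / 4)"
    if x: "x \<in> X" for x
  proof -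
    have "continuous_on UNIV (apply_bcontfun F0)" by simp
    then obtain \<rho> where \<rho>: "\<rho> > 0" "\<And>z. dist z x < \<rho> \<Longrightarrow> dist (apply_bcontfun F0 z) (apply_bcontfun F0 x) < e / 4"
      using e unfolding continuous_on_iff by (metis UNIV_I zero_less_divide_iff zero_less_numeral)
    have "infinite (A \<inter> ball x (min \<delta> \<rho>))"
      using A(3)[of x] X(2) x \<rho>(1) \<delta>(1) unfolding islimpt_eq_infinite_ball by auto
    then obtain T where T: "finite T" "card T = card ?G" "T \<subseteq> A \<inter> ball x (min \<delta> \<rho>)"
      using infinite_arbitrarily_large by blast
    obtain h where h: "bij_betw h ?G T"
      using finite_same_card_bij[of ?G T] T(1,2) by auto
    have "h j \<in> A \<inter> ball x (min \<delta> \<rho>)" if "j \<in> ?G" for j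
      using bij_betwE[OF h] that T(3) by blast
    then have "h j \<in> A \<and> dist x (h j) < \<delta> \<and> dist (h j) x < \<rho>" if "j \<in> ?G" for j
      using that by (simp add: dist_commute)
    then show ?thesis
      using bij_betw_imp_inj_on[OF h] \<rho>(2) by (intro exI[of _ h]) blast
  qed
  then obtain y where y_inj: "\<And>x. x \<in> X \<Longrightarrow> inj_on (y x) ?G"
    and y: "\<And>x j. x \<in> X \<Longrightarrow> j \<in> ?G \<Longrightarrow> y x j \<in> A \<and> dist x (y x j) < \<delta> \<and> dist (apply_bcontfun F0 (y x j)) (apply_bcontfun F0 x) < e / 4"
    by metis
  have y_sep: "(1/2) ^ n < dist (y x j) (y x' j')"
    if "x \<in> X" "x' \<in> X" "j \<in> ?G" "j' \<in> ?G" "x \<noteq> x'" for x x' j j'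
    using \<delta>(2)[OF that(1,2,5)] y[OF that(1,3)] y[OF that(2,4)] by blast
  \<comment> \<open>A factor 3 in place of the 2 in \<open>spread\<close> yields its strict
    inequality.\<close>
  define \<kappa> where "\<kappa> = 3 * (1/2::real) ^ n"
  define Y where "Y = (\<lambda>(x,j). y x j)"
  have Y_inj: "inj_on Y (X \<times> ?G)"
  proof (rule inj_onI)
    fix p q assume pq: "p \<in> X \<times> ?G" "q \<in> X \<times> ?G" "Y p = Y q"
    obtain x j x' j' where eq: "p = (x,j)" "q = (x',j')" by (metis surj_pair)
    have "x = x'"
    proof (rule ccontr)
      assume "x \<noteq> x'"
      then have "(1/2::real) ^ n < 0" using y_sep[of x x' j j'] pq by (simp add: eq Y_def)
      then show False by (simp add: not_less[symmetric])
    qed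
    then show "p = q" using pq y_inj[of x] by (auto simp: eq Y_def inj_on_def)
  qed
  define lift :: "('n \<Rightarrow> nat) \<Rightarrow> real ^ 'n" where "lift j = (\<chi> c. \<kappa> * real (j c))" for j
  define w where "w p = apply_bcontfun F0 (fst p) - apply_bcontfun F0 (Y p) + lift (snd p)" for p
  \<comment> \<open>All nodes are distinct, so a node determines its pair \<open>(x, j)\<close>, and
    the prescribed value is a function of the point.\<close>
  define v where "v z = w (inv_into (X \<times> ?G) Y z)" for z
  have vY: "v (y x j) = apply_bcontfun F0 x - apply_bcontfun F0 (y x j) + lift j" if "x \<in> X" "j \<in> ?G" for x j
    using inv_into_f_f[OF Y_inj, of "(x,j)"] that by (simp add: v_def w_def Y_def)
  have lift_le: "norm (lift j) \<le> e / 4" if j: "j \<in> ?G" for j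
  proof -
    have "norm (lift j) \<le> (\<Sum>c\<in>UNIV. \<bar>lift j $ c\<bar>)" by (rule norm_le_l1_cart)
    also have "\<dots> \<le> (\<Sum>c\<in>(UNIV :: 'n set). \<kappa> * real m)"
      using grid_less[OF j] by (intro sum_mono) (auto simp: lift_def \<kappa>_def intro!: less_imp_le)
    also have "\<dots> \<le> e / 4" using m(3) by (simp add: \<kappa>_def)
    finally show ?thesis .
  qed
  have "norm (v z) \<le> e / 2" if "z \<in> Y ` (X \<times> ?G)" for z
  proof -
    obtain x j where z: "x \<in> X" "j \<in> ?G" "z = y x j" using \<open>z \<in> Y ` (X \<times> ?G)\<close> by (auto simp: Y_def)
    have "norm (v z) \<le> norm (apply_bcontfun F0 x - apply_bcontfun F0 (y x j)) + norm (lift j)"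
      unfolding z(3) vY[OF z(1,2)] by (rule norm_triangle_ineq)
    also have "\<dots> \<le> e / 4 + e / 4"
      using y[OF z(1,2)] lift_le[OF z(2)] by (intro add_mono) (auto simp: dist_norm norm_minus_commute)
    finally show ?thesis by simp
  qed
  then obtain h :: "'a \<Rightarrow>\<^sub>C (real ^ 'n)" where h: "\<And>z. z \<in> Y ` (X \<times> ?G) \<Longrightarrow> apply_bcontfun h z = v z" "norm h \<le> e / 2"
    using bcontfun_interpolation[of "Y ` (X \<times> ?G)" v "e / 2"] X(1) e by auto
  define F where "F = F0 + h"
  have FY: "apply_bcontfun F (y x j) = apply_bcontfun F0 x + lift j" if "x \<in> X" "j \<in> ?G" for x j
  proof -
    have "y x j \<in> Y ` (X \<times> ?G)" using that by (force simp: Y_def)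
    then show ?thesis using h(1) vY[OF that] by (simp add: F_def)
  qed
  have "spread n m X y F"
    unfolding spread_def
  proof (intro ballI allI impI)
    fix x j j' c assume x: "x \<in> X" "j \<in> ?G" "j' \<in> ?G" "j c \<noteq> j' c"
    have "apply_bcontfun F (y x j) $ c - apply_bcontfun F (y x j') $ c = \<kappa> * (real (j c) - real (j' c))"
      using x by (simp add: FY lift_def right_diff_distrib)
    then show "2 * (1/2) ^ n * \<bar>real (j c) - real (j' c)\<bar> < \<bar>apply_bcontfun F (y x j) $ c - apply_bcontfun F (y x j') $ c\<bar>"
      using x(4) by (simp add: \<kappa>_def abs_mult)
  qed
  moreover have "arrangement A s \<epsilon> n m X y"
  proof -
    have "1 \<le> card X" using X(4) packing_number_pos[OF A(2,1)] by simp
    then have "X \<noteq> {}" by auto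
    then show ?thesis
      unfolding arrangement_def using X n m y y_sep by auto
  qed
  ultimately have "F \<in> spread_maps A s k"
    using n(2) unfolding spread_maps_def \<epsilon>_def by blast
  moreover have "dist F F0 < e" using h(2) e by (simp add: F_def dist_norm)
  ultimately show ?thesis by blast
qed

text \<open>Baire category in the complete space of bounded continuous maps: countably many open
  dense sets have a common point, so a single \<open>F\<close> serves all pieces and all
  \<open>k\<close>.\<close>

lemma ex_spread_map:
  fixes \<F> :: "('a::metric_space set \<times> real) set"
  assumes "countable \<F>"
    and "\<And>A s. (A, s) \<in> \<F> \<Longrightarrow> A \<noteq> {} \<and> totally_bdd A \<and> (\<forall>x\<in>A. x islimpt A) \<and> ereal s \<le> upper_box_dim A"
  obtains F :: "'a \<Rightarrow>\<^sub>C (real ^ 'n)" where "\<And>A s k. (A, s) \<in> \<F> \<Longrightarrow> F \<in> spread_maps A s k"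
proof -
  let ?S = "\<lambda>((A, s), k). spread_maps A s k :: ('a \<Rightarrow>\<^sub>C (real ^ 'n)) set"
  have "closure (\<Inter>(?S ` (\<F> \<times> UNIV))) = UNIV"
  proof -
    have "openin euclidean T \<and> euclidean closure_of T = topspace euclidean" if T_in: "T \<in> ?S ` (\<F> \<times> UNIV)" for T
    proof -
      obtain A s k where T: "(A, s) \<in> \<F>" "T = spread_maps A s k" using T_in by auto
      have "F0 \<in> closure T" for F0
        using dense_spread_maps[of A s _ k F0] assms(2)[OF T(1)] unfolding closure_approachable T(2) by blast
      then show ?thesis using open_spread_maps[of A s k] by (auto simp: T(2))
    qed
    then have "euclidean closure_of (\<Inter>(?S ` (\<F> \<times> UNIV))) = topspace euclidean"
      using assms(1) by (intro Baire_category) (auto simp: completely_metrizable_space_euclidean)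
    then show ?thesis by simp
  qed
  then have "\<Inter>(?S ` (\<F> \<times> UNIV)) \<noteq> {}" by (metis closure_empty UNIV_not_empty)
  then obtain F where F: "F \<in> \<Inter>(?S ` (\<F> \<times> UNIV))" unfolding ex_in_conv[symmetric] by (elim exE)
  show thesis
  proof (rule that[of F])
    fix A s k assume "(A, s) \<in> \<F>"
    then have "?S ((A, s), k) \<in> ?S ` (\<F> \<times> UNIV)" by (intro imageI) simp
    from InterD[OF F this] show "F \<in> spread_maps A s k" by simp
  qed
qed

subsection \<open>Prevalence\<close>

text \<open>For each piece, the bad event at level \<open>k\<close> has probability at most
  \<open>1 / Suc k\<close> after any translation. Almost surely, infinitely many levels are
  therefore good, and each good level of large index provides a good scale.\<close>

lemma prevalent_packing_number_graph:
  fixes \<F> :: "('a::metric_space set \<times> real) set"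
  assumes K: "compact (UNIV :: 'a set)" and \<F>: "countable \<F>"
    and pieces: "\<And>A s. (A, s) \<in> \<F> \<Longrightarrow> A \<noteq> {} \<and> (\<forall>x\<in>A. x islimpt A) \<and> ereal s \<le> upper_box_dim A"
  shows "\<exists>S :: ('a \<Rightarrow>\<^sub>C (real ^ 'n)) set. prevalent S \<and>
    (\<forall>f A s v. f \<in> S \<longrightarrow> (A, s) \<in> \<F> \<longrightarrow> v < s + real CARD('n) \<longrightarrow>
       frequently (\<lambda>n. 2 powr (real n * v) \<le> real (packing_number n (graph_on f A))) sequentially)"
proof -
  obtain F :: "'a \<Rightarrow>\<^sub>C (real ^ 'n)" where F: "\<And>A s k. (A, s) \<in> \<F> \<Longrightarrow> F \<in> spread_maps A s k"
    using ex_spread_map[OF \<F>] pieces totally_bdd_UNIV[OF K] by metis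
  \<comment> \<open>Membership in \<open>\<F>\<close> is kept inside the formula so that the choice
    functions are total in \<open>p\<close> and \<open>k\<close>.\<close>
  have "\<exists>n m X y. p \<in> \<F> \<longrightarrow> k \<le> n \<and> arrangement (fst p) (snd p) (1 / Suc k) n m X y \<and> spread n m X y F" for p k
    using F[of "fst p" "snd p" k] unfolding spread_maps_def by auto
  then obtain n m X y where nmXy: "\<And>p k. p \<in> \<F> \<Longrightarrow> k \<le> n p k \<and>
      arrangement (fst p) (snd p) (1 / Suc k) (n p k) (m p k) (X p k) (y p k) \<and> spread (n p k) (m p k) (X p k) (y p k) F"
    by metis
  define d where "d = CARD('n)"
  define L where "L p k = 2 powr (real (n p k) * (1 / real (Suc k)))" for p k
  have L: "L p k > 0" for p k by (simp add: L_def)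
  define Bad where "Bad p k = {f :: 'a \<Rightarrow>\<^sub>C (real ^ 'n).
      real (card (X p k) * m p k ^ d) * L p k \<le> collisions (n p k) (m p k) (X p k) (y p k) f}" for p k
  have Bad: "Bad p k \<in> sets borel" for p k
  proof -
    have "{f \<in> space borel. real (card (X p k) * m p k ^ d) * L p k \<le> collisions (n p k) (m p k) (X p k) (y p k) f} \<in> sets borel"
      by measurable
    then show ?thesis by (simp add: Bad_def)
  qed
  \<comment> \<open>A countable union of lower limits of bad events: outside \<open>B\<close>, every
    piece has infinitely many good levels.\<close>
  define B where "B = (\<Union>p\<in>\<F>. \<Union>k0. \<Inter>k\<in>{k0..}. Bad p k)"
  have B: "B \<in> sets borel"
    unfolding B_def
  proof -
    have "(\<Inter>k\<in>{k0..}. Bad p k) \<in> sets borel" for p k0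
      by (rule sets.countable_INT') (auto simp: Bad)
    then have "(\<Union>k0. \<Inter>k\<in>{k0..}. Bad p k) \<in> sets borel" for p
      by (intro sets.countable_UN image_subsetI)
    then show "(\<Union>p\<in>\<F>. \<Union>k0. \<Inter>k\<in>{k0..}. Bad p k) \<in> sets borel"
      by (intro sets.countable_UN'[OF \<F>] image_subsetI)
  qed
  have mpos: "m p k > 0" if p: "p \<in> \<F>" for p k
  proof -
    have "2 powr (real (n p k) * (1 - 1 / Suc k)) \<le> real (m p k)"
      using nmXy[OF p, of k] unfolding arrangement_def by blast
    moreover have "0 < 2 powr (real (n p k) * (1 - 1 / Suc k))" by simp
    ultimately have "0 < real (m p k)" by linarith
    then show ?thesis by simp
  qed
  have null: "emeasure (distr cube_measure borel (stretch F)) ((\<lambda>b. b + g) ` B) = 0" for g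
  proof -
    interpret prob_space "cube_measure :: (real ^ 'n) measure" by (rule prob_space_cube_measure)
    define T where "T p k = {t. stretch F t - g \<in> Bad p k}" for p k
    have T: "T p k \<in> sets borel" for p k
      using measurable_sets[OF measurable_stretch_diff Bad, of F g p k] by (simp add: T_def vimage_def)
    have meas_T: "measure cube_measure (T p k) \<le> 1 / Suc k" if p: "p \<in> \<F>" for p k
    proof -
      have ar: "arrangement (fst p) (snd p) (1 / Suc k) (n p k) (m p k) (X p k) (y p k)"
        and sp: "spread (n p k) (m p k) (X p k) (y p k) F"
        using nmXy[OF p, of k] by auto
      have "measure cube_measure (T p k) \<le> (3 + 2 * real (n p k)) ^ CARD('n) / L p k"
        unfolding T_def Bad_def d_def mem_Collect_eq
        using ar by (intro measure_many_collisions_le[OF sp _ _ mpos[OF p] _ L]) (auto simp: arrangement_def)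
      also have "\<dots> \<le> 1 / Suc k"
      proof -
        have "(3 + 2 * real (n p k)) ^ CARD('n) \<le> 1 / Suc k * L p k"
          using ar unfolding arrangement_def L_def by blast
        then show ?thesis using L[of p k] by (simp add: divide_le_eq)
      qed
      finally show ?thesis .
    qed
    have N: "(\<Inter>k\<in>{k0..}. T p k) \<in> null_sets cube_measure" if p: "p \<in> \<F>" for p k0
    proof -
      have S: "(\<Inter>k\<in>{k0..}. T p k) \<in> sets cube_measure"
        by (rule sets.countable_INT') (auto simp: T)
      \<comment> \<open>The intersection lies in \<open>T p k\<close> for every
        \<open>k \<ge> k0\<close>, and these measures tend to 0.\<close>
      have "measure cube_measure (\<Inter>k\<in>{k0..}. T p k) \<le> 0"
      proof (rule ccontr)
        assume "\<not> ?thesis"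
        then have "0 < measure cube_measure (\<Inter>k\<in>{k0..}. T p k)" by (simp only: not_le)
        then obtain k where k: "1 / real (Suc k) < measure cube_measure (\<Inter>k\<in>{k0..}. T p k)"
          by (rule nat_approx_posE)
        have "measure cube_measure (\<Inter>k\<in>{k0..}. T p k) \<le> measure cube_measure (T p (max k0 k))"
          by (rule finite_measure_mono) (auto simp: T)
        also have "\<dots> \<le> 1 / real (Suc (max k0 k))" by (rule meas_T[OF p])
        also have "\<dots> \<le> 1 / real (Suc k)" by (intro divide_left_mono) auto
        finally show False using k by simp
      qed
      then have "emeasure cube_measure (\<Inter>k\<in>{k0..}. T p k) = 0"
        by (simp add: emeasure_eq_measure measure_le_0_iff)
      then show ?thesis using S by (intro null_setsI)
    qed
    have "(\<Union>p\<in>\<F>. \<Union>k0. \<Inter>k\<in>{k0..}. T p k) \<in> null_sets cube_measure"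
      by (intro null_sets_UN'[OF \<F>] null_sets_UN N)
    moreover have "stretch F -` ((\<lambda>b. b + g) ` B) = (\<Union>p\<in>\<F>. \<Union>k0. \<Inter>k\<in>{k0..}. T p k)"
    proof -
      \<comment> \<open>A translate is a preimage under subtraction, which turns shyness into the
        estimate for \<open>stretch F t - g\<close>.\<close>
      have "(\<lambda>b. b + g) ` B = {f. f - g \<in> B}"
        by (auto simp: image_iff intro!: bexI[where x = "_ - g"])
      then have "stretch F -` ((\<lambda>b. b + g) ` B) = {t. stretch F t - g \<in> B}" by (simp add: vimage_def)
      also have "\<dots> = (\<Union>p\<in>\<F>. \<Union>k0. \<Inter>k\<in>{k0..}. T p k)"
        unfolding B_def T_def by (rule set_eqI) (simp only: mem_Collect_eq UN_iff INT_iff)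
      finally show ?thesis .
    qed
    moreover have "(\<lambda>b. b + g) ` B \<in> sets borel"
    proof -
      have eq: "(\<lambda>b. b + g) ` B = (\<lambda>f. f - g) -` B \<inter> space borel"
        by (auto simp: image_iff intro!: bexI[where x = "_ - g"])
      have "continuous_on UNIV (\<lambda>f :: 'a \<Rightarrow>\<^sub>C (real ^ 'n). f - g)" by (intro continuous_intros)
      from measurable_sets[OF borel_measurable_continuous_onI[OF this] B]
      show ?thesis unfolding eq .
    qed
    moreover have "stretch F \<in> borel_measurable cube_measure"
      using measurable_stretch_diff[of F 0] by simp
    ultimately show ?thesis by (simp add: emeasure_distr null_setsD1)
  qed
  have "prevalent (- B)"
    unfolding prevalent_def shy_def
  proof (intro bexI[of _ B] conjI exI[of _ "distr cube_measure borel (stretch F)"] allI null)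
    have "stretch F \<in> borel_measurable cube_measure"
      using measurable_stretch_diff[of F 0] by simp
    then show "prob_space (distr cube_measure borel (stretch F))"
      by (rule prob_space.prob_space_distr[OF prob_space_cube_measure])
  qed (use B in auto)
  moreover have "frequently (\<lambda>n. 2 powr (real n * v) \<le> real (packing_number n (graph_on f A))) sequentially"
    if f: "f \<in> - B" and p: "(A, s) \<in> \<F>" and v: "v < s + real CARD('n)" for f A s v
    unfolding frequently_sequentially
  proof
    fix N :: nat
    define \<gamma> where "\<gamma> = s + real d - v"
    have \<gamma>: "\<gamma> > 0" using v by (simp add: \<gamma>_def d_def)
    \<comment> \<open>\<open>k1\<close> makes the total loss \<open>(d + 2) * \<epsilon>\<close> at
      most \<open>\<gamma> / 2\<close>; it comes from the \<open>d\<close> sides of the grid, from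
      \<open>X\<close> and from \<open>L\<close>. \<open>k2\<close> pays for the passage from scale
      \<open>n\<close> to \<open>Suc n\<close>, a further factor \<open>2 powr v\<close>.\<close>
    obtain k1 :: nat where k1: "(real d + 2) * 2 / \<gamma> \<le> real k1" using real_arch_simple by blast
    obtain k2 :: nat where k2: "2 * v / \<gamma> \<le> real k2" using real_arch_simple by blast
    define k0 where "k0 = max N (max k1 k2)"
    obtain k where k: "k0 \<le> k" "f \<notin> Bad (A, s) k" using f p unfolding B_def by auto
    define \<epsilon> where "\<epsilon> = 1 / real (Suc k)"
    let ?n = "n (A, s) k" and ?m = "m (A, s) k" and ?X = "X (A, s) k" and ?y = "y (A, s) k"
    have nk: "k \<le> ?n" and ar: "arrangement A s \<epsilon> ?n ?m ?X ?y"
      using nmXy[OF p, of k] by (auto simp: \<epsilon>_def)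
    define P where "P = real (packing_number (Suc ?n) (graph_on f A))"
    have few: "collisions ?n ?m ?X ?y f \<le> card ?X * ?m ^ CARD('n) * L (A, s) k"
      using k(2) by (simp add: Bad_def d_def)
    have "card ?X * ?m ^ d \<le> L (A, s) k * P"
      unfolding P_def d_def
      by (rule packing_number_ge_of_collisions[OF K _ _ mpos[OF p] _ _ few])
        (use ar in \<open>auto simp: arrangement_def\<close>)
    moreover have "2 powr (real ?n * (s - \<epsilon>)) * (2 powr (real ?n * (1 - \<epsilon>))) ^ d \<le> real (card ?X) * real ?m ^ d"
      using ar unfolding arrangement_def by (intro mult_mono power_mono) auto
    ultimately have "2 powr (real ?n * (s - \<epsilon>)) * (2 powr (real ?n * (1 - \<epsilon>))) ^ d \<le> 2 powr (real ?n * \<epsilon>) * P"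
      by (simp add: L_def \<epsilon>_def)
    also have "(2 powr (real ?n * (1 - \<epsilon>))) ^ d = 2 powr (real ?n * (1 - \<epsilon>) * real d)"
      by (simp add: powr_powr[symmetric] powr_realpow)
    finally have le: "2 powr (real ?n * (s - \<epsilon>) + real ?n * (1 - \<epsilon>) * real d) \<le> 2 powr (real ?n * \<epsilon>) * P"
      by (simp only: powr_add)
    have "2 powr (real ?n * \<epsilon>) * 2 powr (real (Suc ?n) * v) \<le> 2 powr (real ?n * (s - \<epsilon>) + real ?n * (1 - \<epsilon>) * real d)"
    proof -
      have "(real d + 2) * 2 / \<gamma> \<le> real (Suc k)" using k1 k(1) by (simp add: k0_def)
      then have "(real d + 2) * \<epsilon> \<le> \<gamma> / 2" using \<gamma> by (simp add: \<epsilon>_def field_simps)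
      then have "real ?n * ((real d + 2) * \<epsilon>) \<le> real ?n * (\<gamma> / 2)" by (intro mult_left_mono) auto
      moreover have "v \<le> real ?n * (\<gamma> / 2)"
      proof -
        have "2 * v / \<gamma> \<le> real ?n" using k2 k(1) nk by (simp add: k0_def)
        then show ?thesis using \<gamma> by (simp add: field_simps)
      qed
      ultimately have "real ?n * \<epsilon> + real (Suc ?n) * v \<le> real ?n * (s - \<epsilon>) + real ?n * (1 - \<epsilon>) * real d"
        by (simp add: \<gamma>_def algebra_simps)
      then show ?thesis by (simp only: powr_add[symmetric] powr_le_cancel_iff)
    qed
    also note le
    finally have "2 powr (real (Suc ?n) * v) \<le> P"
      by (subst (asm) mult_le_cancel_left_pos) simp_all
    moreover have "N \<le> Suc ?n" using k(1) nk by (simp add: k0_def)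
    ultimately show "\<exists>n\<ge>N. 2 powr (real n * v) \<le> real (packing_number n (graph_on f A))"
      unfolding P_def by blast
  qed
  ultimately show ?thesis by blast
qed

theorem theorem1p12:
  assumes "compact (UNIV :: 'a::metric_space set)"
    and "uncountable (UNIV :: 'a set)"
  shows "for_prevalent (\<lambda>f :: 'a \<Rightarrow>\<^sub>C (real ^ 'n).
           packing_dim (graph_of f) = packing_dim (UNIV :: 'a set) + ereal (real CARD('n)))"
proof -
  obtain \<U> :: "'a set set" where \<U>: "countable \<U>" "\<And>U. U \<in> \<U> \<Longrightarrow> open U"
    "\<And>V x. open V \<Longrightarrow> x \<in> V \<Longrightarrow> \<exists>U\<in>\<U>. x \<in> U \<and> U \<subseteq> V"
    by (rule compact_countable_basis[OF assms(1)]) (rule that)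
  \<comment> \<open>Rationals keep the family of pieces countable. Negative ones matter: if the
    packing dimension of the domain is 0, they are the only members of \<open>R\<close>.\<close>
  define R where "R = {r :: rat. ereal (real_of_rat r) < packing_dim (UNIV :: 'a set)}"
  define \<F> where "\<F> = (\<lambda>(U, r). (U \<inter> kernel \<U> (real_of_rat r), real_of_rat r)) `
      {(U, r) \<in> \<U> \<times> R. U \<inter> kernel \<U> (real_of_rat r) \<noteq> {}}"
  have "countable ({(U, r) \<in> \<U> \<times> R. U \<inter> kernel \<U> (real_of_rat r) \<noteq> {}})"
    by (rule countable_subset[OF _ countable_SIGMA[OF \<U>(1), of "\<lambda>_. R"]]) auto
  then have cnt: "countable \<F>" unfolding \<F>_def by (rule countable_image)
  have pieces: "A \<noteq> {} \<and> (\<forall>x\<in>A. x islimpt A) \<and> ereal s \<le> upper_box_dim A" if As: "(A, s) \<in> \<F>" for A s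
  proof -
    obtain U r where U: "U \<in> \<U>" "U \<inter> kernel \<U> s \<noteq> {}" "A = U \<inter> kernel \<U> s"
      using As by (auto simp: \<F>_def)
    then show ?thesis
      using kernel_Int_upper_box_dim[OF \<U>(1) U(1,2)] kernel_Int_islimpt[OF \<U> U(1)] by simp
  qed
  have "\<exists>S :: ('a \<Rightarrow>\<^sub>C (real ^ 'n)) set. prevalent S \<and>
    (\<forall>f A s v. f \<in> S \<longrightarrow> (A, s) \<in> \<F> \<longrightarrow> v < s + real CARD('n) \<longrightarrow>
       frequently (\<lambda>n. 2 powr (real n * v) \<le> real (packing_number n (graph_on f A))) sequentially)"
    by (rule prevalent_packing_number_graph[OF assms(1) cnt]) (rule pieces)
  then obtain S :: "('a \<Rightarrow>\<^sub>C (real ^ 'n)) set" where S: "prevalent S"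
    "\<And>f A s v. f \<in> S \<Longrightarrow> (A, s) \<in> \<F> \<Longrightarrow> v < s + real CARD('n) \<Longrightarrow>
       frequently (\<lambda>n. 2 powr (real n * v) \<le> real (packing_number n (graph_on f A))) sequentially"
    by blast
  have "packing_dim (graph_of f) = packing_dim (UNIV :: 'a set) + ereal (real CARD('n))" if f: "f \<in> S" for f
  proof (rule antisym)
    show "packing_dim (graph_of f) \<le> packing_dim (UNIV :: 'a set) + ereal (real CARD('n))"
      by (rule packing_dim_graph_le[OF assms(1)])
    have ge: "ereal (real_of_rat r + real CARD('n)) \<le> packing_dim (graph_of f)" if r: "r \<in> R" for r
    proof (rule packing_dim_graph_ge[OF assms(1)])
      let ?M = "kernel \<U> (real_of_rat r)"
      show "closed ?M" by (rule closed_kernel[OF \<U>(2)])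
      show "?M \<noteq> {}"
        using r by (intro kernel_nonempty \<U>(1) not_small_UNIV assms(2)) (simp add: R_def)
      fix V :: "'a set" and v assume V: "open V" "V \<inter> ?M \<noteq> {}" and v: "v < real_of_rat r + real CARD('n)"
      then obtain x where x: "x \<in> V" "x \<in> ?M" by blast
      then obtain U where U: "U \<in> \<U>" "x \<in> U" "U \<subseteq> V" using \<U>(3)[OF V(1)] by blast
      \<comment> \<open>A basic set inside \<open>V\<close> suffices, because packing numbers are
        monotone.\<close>
      have "(U \<inter> ?M, real_of_rat r) \<in> \<F>"
        unfolding \<F>_def using U x r by (intro image_eqI[of _ _ "(U, r)"]) auto
      from S(2)[OF f this v]
      show "frequently (\<lambda>n. 2 powr (real n * v) \<le> real (packing_number n (graph_on f (V \<inter> ?M)))) sequentially"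
      proof (rule frequently_elim1)
        fix n assume "2 powr (real n * v) \<le> real (packing_number n (graph_on f (U \<inter> ?M)))"
        also have "packing_number n (graph_on f (U \<inter> ?M)) \<le> packing_number n (graph_on f (V \<inter> ?M))"
          using U(3) by (intro packing_number_mono totally_bdd_graph_on assms(1) graph_on_mono) auto
        finally show "2 powr (real n * v) \<le> real (packing_number n (graph_on f (V \<inter> ?M)))" by simp
      qed
    qed
    \<comment> \<open>With the dimension of the target subtracted, a rational can be inserted
      between two extended reals; an infinite packing dimension is covered by the same
      argument.\<close>
    have "packing_dim (UNIV :: 'a set) \<le> packing_dim (graph_of f) - ereal (real CARD('n))"
    proof (rule ccontr)
      assume "\<not> ?thesis"
      then have lt: "packing_dim (graph_of f) - ereal (real CARD('n)) < packing_dim (UNIV :: 'a set)"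
        by (simp only: not_le)
      obtain r where r: "packing_dim (graph_of f) - ereal (real CARD('n)) < ereal (real_of_rat r)"
          "ereal (real_of_rat r) < packing_dim (UNIV :: 'a set)"
        using ereal_dense3[OF lt] by blast
      then have "ereal (real_of_rat r) + ereal (real CARD('n)) \<le> packing_dim (graph_of f)"
        using ge[of r] by (simp add: R_def)
      then show False using r(1) by (simp add: ereal_minus_less)
    qed
    then show "packing_dim (UNIV :: 'a set) + ereal (real CARD('n)) \<le> packing_dim (graph_of f)"
      by (simp add: ereal_le_minus)
  qed
  then show ?thesis unfolding for_prevalent_def using S(1) by blast
qed

end
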